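(* Let $q,q'$ be prime powers and $n,r,n',r'$ integers with $n>2r$, $n'>2r'$ and $[n]_q/[r]_q=[n']_{q'}/[r']_{q'}$. If there is a homomorphism $qK_{n:r}\to q'K_{n':r'}$, then \[\left\{\frac{[k]_q}{[r]_q}: k\in[r]\right\}\subseteq\left\{\frac{[k']_{q'}}{[r']_{q'}}: k'\in[r']\right\}.\] In particular, $[n']_{q'}$ and $[r']_{q'}$ are integer multiples of $[n]_q$ and $[r]_q$, respectively.
   Context: $[k]_q:=\frac{q^k-1}{q-1}=\sum_{i=0}^{k-1}q^i$ and $[r]=\{1,\dots,r\}$. The $q$-Kneser graph $qK_{n:r}$ has as vertices the $r$-dimensional subspaces of $\mathbb{F}_q^n$, two being adjacent iff their intersection is the zero subspace. A homomorphism is an adjacency-preserving map between vertex sets. *)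

theory Defs
  imports "HOL-Analysis.Analysis"
begin

definition qint :: "nat \<Rightarrow> nat \<Rightarrow> nat" where
  "qint q k = (\<Sum>i<k. q ^ i)"

text \<open>Vertices of the q-Kneser graph qK_{n:r}: the r-dimensional subspaces of F^n,
  where F = 'a is a finite field (so q = CARD('a)) and n = CARD('n).\<close>
definition qkneser_vertices :: "nat \<Rightarrow> (('a::field) ^ 'n) set set" where
  "qkneser_vertices r = {U. vec.subspace U \<and> vec.dim U = r}"

definition qkneser_adj :: "(('a::field) ^ 'n) set \<Rightarrow> ('a ^ 'n) set \<Rightarrow> bool" where
  "qkneser_adj U W \<longleftrightarrow> U \<inter> W = {0}"

definition qkneser_hom ::
  "nat \<Rightarrow> nat \<Rightarrow> (((('a::field) ^ 'n) set \<Rightarrow> (('b::field) ^ 'm) set)) \<Rightarrow> bool" where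
  "qkneser_hom r r' f \<longleftrightarrow>
     (\<forall>U \<in> (qkneser_vertices r :: ('a ^ 'n) set set). f U \<in> (qkneser_vertices r' :: ('b ^ 'm) set set)) \<and>
     (\<forall>U \<in> (qkneser_vertices r :: ('a ^ 'n) set set). \<forall>W \<in> qkneser_vertices r.
        qkneser_adj U W \<longrightarrow> qkneser_adj (f U) (f W))"

end

theory Submission
  imports Defs
begin

text \<open>
  For a point \<open>p'\<close> of the target space, the \<open>r\<close>-spaces \<open>U\<close> with \<open>p' \<subseteq> f U\<close> form an intersecting family.
  On average over \<open>p'\<close> these families attain the Erdos-Ko-Rado bound for vector spaces, so each of
  them does, and hence each is the star of a point \<open>\<phi> p'\<close>. Every \<open>r\<close>-space receives the same weight
  under \<open>p \<mapsto> card (\<phi>\<^sup>-\<^sup>1 p)\<close>, so this weight is a constant \<open>c\<close>, which gives \<open>[n'] = c [n]\<close> and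
  \<open>[r'] = c [r]\<close>. For a \<open>k\<close>-space \<open>K\<close>, the intersection of all \<open>f U\<close> with \<open>K \<subseteq> U\<close> is a subspace whose
  points are those mapped into \<open>K\<close> by \<open>\<phi>\<close>, whence \<open>[k'] = c [k]\<close> for its dimension \<open>k'\<close>.

  The Erdos-Ko-Rado bound is Hoffman's ratio bound. In the case of equality the indicator function
  of the family \<open>S\<close> is \<open>U \<mapsto> \<Sum>p\<subseteq>U. a p\<close> for some function \<open>a\<close> on points with \<open>\<Sum> a = 1\<close>. Since it is
  0/1-valued, double counting gives \<open>\<Sum> a\<^sup>2 = 1\<close>. As \<open>n > 2r\<close>, the same two sums are 1 over the points
  of every \<open>(r+1)\<close>-space above a member of \<open>S\<close>, so \<open>a\<close> is supported in every member of \<open>S\<close>.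
\<close>

section \<open>Counting subspaces\<close>

lemma CARD_field_ge_2: "2 \<le> CARD('a::{field,finite})" 
proof -
  have "card {0::'a,1} \<le> CARD('a)" by (rule card_mono) auto
  then show ?thesis by simp
qed

section \<open>Arithmetic of q-integers\<close>

lemma qint_0 [simp]: "qint q 0 = 0"
  by (simp add: qint_def)

lemma qint_Suc: "qint q (Suc k) = qint q k + q ^ k"
  by (simp add: qint_def)

lemma qint_1 [simp]: "qint q (Suc 0) = 1"
  by (simp add: qint_Suc)

lemma qint_add: "qint q (j + k) = qint q j + q ^ j * qint q k"
  by (induction k) (simp_all add: qint_Suc algebra_simps power_add)

text \<open>The geometric sum formula without division. For \<open>q = 0\<close> truncated
  subtraction makes both sides 0.\<close>

lemma qint_mult_diff: "qint q k * (q - 1) = q ^ k - 1"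
proof (cases q)
  case (Suc p)
  have "qint q k * p + 1 = q ^ k"
    by (induction k) (simp_all add: Suc qint_Suc algebra_simps)
  then show ?thesis by (simp add: Suc)
qed (induction k, auto simp: qint_Suc)

lemma qint_pos: "0 < q \<Longrightarrow> 0 < k \<Longrightarrow> 0 < qint q k"
  by (cases k) (auto simp: qint_Suc)

lemma qint_strict_mono:
  assumes "0 < q" "j < k" shows "qint q j < qint q k"
  using assms qint_add[of q j "k - j"] qint_pos[of q "k - j"] by simp

section \<open>Subspaces of fixed dimension and their sizes\<close>

abbreviation Gr :: "nat \<Rightarrow> (('a::field) ^ 'n) set set" where
  "Gr \<equiv> qkneser_vertices"

lemma GrD:
  assumes "U \<in> Gr k"
  shows "vec.subspace U" "vec.dim U = k"
  using assms by (simp_all add: qkneser_vertices_def)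

lemma GrI: "vec.subspace U \<Longrightarrow> vec.dim U = k \<Longrightarrow> U \<in> Gr k"
  by (simp add: qkneser_vertices_def)

lemma Gr_0: "Gr 0 = {{0}}"
  using vec.subspace_0 by (force simp: qkneser_vertices_def)

lemma Gr_eqI: "U \<in> Gr k \<Longrightarrow> V \<in> Gr k \<Longrightarrow> U \<subseteq> V \<Longrightarrow> U = V"
  by (simp add: GrD vec.subspace_dim_equal)

lemma Gr_dim_le: "U \<in> Gr j \<Longrightarrow> V \<in> Gr k \<Longrightarrow> U \<subseteq> V \<Longrightarrow> j \<le> k"
  using GrD vec.dim_subset by metis

lemma subspace_Gr: "vec.subspace U \<Longrightarrow> U \<in> Gr (vec.dim U)"
  by (simp add: GrI)

lemma span_insert_Gr:
  assumes "X \<in> Gr k" "v \<notin> X"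
  shows "vec.span (insert v X) \<in> Gr (Suc k)"
  using assms by (intro GrI) (simp_all add: GrD vec.dim_insert vec.span_eq_iff[THEN iffD2])

text \<open>Each vector of the span is \<open>c *s v + x\<close> for exactly one scalar
  \<open>c\<close> and one \<open>x\<close> in \<open>X\<close>: two different scalars would allow a
  division that puts \<open>v\<close> into \<open>X\<close>.\<close>

lemma card_span_insert:
  fixes X :: "('a::{field,finite} ^ 'n) set"
  assumes "vec.subspace X" "v \<notin> X"
  shows "card (vec.span (insert v X)) = CARD('a) * card X"
proof -
  have X: "vec.span X = X"
    using assms(1) by (simp add: vec.span_eq_iff)
  have inj: "inj_on (\<lambda>(c, x). c *s v + x) (UNIV \<times> X)"
  proof (rule inj_onI, clarify, rule conjI)
    fix c d x y assume x: "x \<in> X" and y: "y \<in> X" and eq: "c *s v + x = d *s v + y"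
    have d: "(c - d) *s v = y - x"
      using eq by (simp add: vec.scale_left_diff_distrib algebra_simps)
    have dX: "(c - d) *s v \<in> X"
      unfolding d using assms(1) x y by (simp add: vec.subspace_diff)
    show "c = d"
    proof (rule ccontr)
      assume "c \<noteq> d"
      then have "v = inverse (c - d) *s ((c - d) *s v)"
        by (metis left_inverse right_minus_eq vec.scale_one vec.scale_scale)
      also have "\<dots> \<in> X"
        using assms(1) dX by (rule vec.subspace_scale)
      finally show False using assms(2) by simp
    qed
    then show "x = y" using d by simp
  qed
  have "vec.span (insert v X) = (\<lambda>(c, x). c *s v + x) ` (UNIV \<times> X)"
  proof (intro equalityI subsetI)
    fix x assume "x \<in> vec.span (insert v X)"
    then obtain c where "x - c *s v \<in> X"
      by (auto simp: vec.span_insert X)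
    then show "x \<in> (\<lambda>(c, x). c *s v + x) ` (UNIV \<times> X)"
      by (intro image_eqI[of _ _ "(c, x - c *s v)"]) auto
  next
    fix x assume "x \<in> (\<lambda>(c, x). c *s v + x) ` (UNIV \<times> X)"
    then obtain c y where "x = c *s v + y" "y \<in> X" by auto
    then show "x \<in> vec.span (insert v X)"
      by (auto simp: vec.span_insert X intro!: exI[of _ c])
  qed
  then have "card (vec.span (insert v X)) = card (UNIV \<times> X :: ('a \<times> _) set)"
    using inj by (simp add: card_image)
  then show ?thesis by simp
qed

lemma card_subspace:
  fixes X :: "('a::{field,finite} ^ 'n) set"
  assumes "X \<in> Gr k"
  shows "card X = CARD('a) ^ k"
  using assms
proof (induction k arbitrary: X)
  case 0
  then show ?case by (simp add: Gr_0)
next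
  case (Suc k)
  obtain B where B: "B \<subseteq> X" "vec.independent B" "X \<subseteq> vec.span B" "card B = Suc k"
    using vec.basis_exists[of X] Suc.prems GrD(2) by metis
  obtain v B' where B': "B = insert v B'" "v \<notin> B'" "card B' = k"
    using B(4) by (metis card_Suc_eq)
  have X: "X = vec.span B"
    using B Suc.prems GrD(1) vec.span_subspace by metis
  have v: "v \<notin> vec.span B'" "vec.independent B'"
    using B(2) B'(1,2) by (simp_all add: vec.independent_insert)
  then have Y: "vec.span B' \<in> Gr k"
    using B'(3) by (intro GrI) (simp_all add: vec.dim_eq_card_independent)
  have "X = vec.span (insert v (vec.span B'))"
    unfolding X B'(1) vec.span_insert vec.span_span by (rule refl)
  then show ?case
    using card_span_insert[OF GrD(1)[OF Y] v(1)] Suc.IH[OF Y] by simp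
qed

section \<open>Counting covers and hyperplanes\<close>

lemma span_insert_subset: "Z \<in> Gr k \<Longrightarrow> X \<subseteq> Z \<Longrightarrow> v \<in> Z \<Longrightarrow> vec.span (insert v X) \<subseteq> Z"
  by (rule vec.span_minimal) (auto dest: GrD)

text \<open>This is why the sets \<open>Z - X\<close>, for the covers \<open>Z\<close> of
  \<open>X\<close>, are pairwise disjoint.\<close>

lemma cover_eq_span_insert:
  assumes "X \<in> Gr j" "Z \<in> Gr (Suc j)" "X \<subseteq> Z" "v \<in> Z" "v \<notin> X"
  shows "Z = vec.span (insert v X)"
  using assms Gr_eqI[OF span_insert_Gr] span_insert_subset by metis

text \<open>The covers \<open>Z\<close> partition \<open>Y - X\<close> into the sets
  \<open>Z - X\<close>, each of size \<open>q ^ Suc j - q ^ j\<close>. Dividing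
  \<open>q ^ k - q ^ j\<close> by this size gives the q-integer.\<close>

lemma card_covers:
  fixes X Y :: "('a::{field,finite} ^ 'n) set"
  assumes X: "X \<in> Gr j" and Y: "Y \<in> Gr k" and XY: "X \<subseteq> Y"
  shows "card {Z \<in> Gr (Suc j). X \<subseteq> Z \<and> Z \<subseteq> Y} = qint CARD('a) (k - j)"
proof -
  let ?q = "CARD('a)" and ?C = "{Z \<in> Gr (Suc j). X \<subseteq> Z \<and> Z \<subseteq> Y}"
  have q: "?q \<ge> 2" by (rule CARD_field_ge_2)
  have cover: "Z = vec.span (insert v X)" if "Z \<in> ?C" "v \<in> Z" "v \<notin> X" for Z v
    using that cover_eq_span_insert[OF X] by blast
  have U: "Y - X = (\<Union>Z\<in>?C. Z - X)"
  proof (intro equalityI subsetI)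
    fix v assume v: "v \<in> Y - X"
    have "vec.span (insert v X) \<in> ?C"
      using v span_insert_Gr[OF X] span_insert_subset[OF Y XY] vec.span_superset by blast
    moreover have "v \<in> vec.span (insert v X)"
      by (simp add: vec.span_base)
    ultimately show "v \<in> (\<Union>Z\<in>?C. Z - X)" using v by blast
  qed auto
  have "card (Y - X) = (\<Sum>Z\<in>?C. card (Z - X))"
    unfolding U by (rule card_UN_disjoint) (use cover in \<open>auto, blast+\<close>)
  also have "\<dots> = (\<Sum>Z\<in>?C. ?q ^ Suc j - ?q ^ j)"
    using card_subspace[OF X] card_subspace[where k = "Suc j" and ?'a = 'a and ?'n = 'n]
    by (intro sum.cong refl) (simp add: card_Diff_subset)
  finally have 1: "card ?C * (?q ^ Suc j - ?q ^ j) = ?q ^ k - ?q ^ j"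
    using card_subspace[OF X] card_subspace[OF Y] XY by (simp add: card_Diff_subset)
  have "j \<le> k" using Gr_dim_le[OF X Y XY] .
  then have 2: "?q ^ k = ?q ^ j * ?q ^ (k - j)"
    by (simp flip: power_add)
  have "?q ^ j * (card ?C * (?q - 1)) = ?q ^ j * (?q ^ (k - j) - 1)"
    using 1 unfolding 2 by (simp add: diff_mult_distrib diff_mult_distrib2 mult_ac)
  then have "card ?C * (?q - 1) = qint ?q (k - j) * (?q - 1)"
    unfolding qint_mult_diff using q by simp
  then show ?thesis using q by simp
qed

lemma sum_card_swap:
  assumes "finite A" "finite B"
  shows "(\<Sum>a\<in>A. card {b \<in> B. R a b}) = (\<Sum>b\<in>B. card {a \<in> A. R a b})"
  using sum.swap_restrict[OF assms, of "\<lambda>_ _. 1::nat" R] by simp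

text \<open>Double counting replaces duality. Between the covers \<open>P\<close> of
  \<open>X\<close> and the hyperplanes \<open>H\<close> of \<open>Y\<close>, each \<open>P\<close>
  lies in as many \<open>H\<close> (by induction) as each \<open>H\<close> contains \<open>P\<close>
  (by \<open>card_covers\<close>), so there are equally many of both.\<close>

lemma card_hyperplanes_containing_aux:
  fixes X Y :: "('a::{field,finite} ^ 'n) set"
  assumes "X \<in> Gr j" "Y \<in> Gr (Suc (j + d))" "X \<subseteq> Y"
  shows "card {H \<in> Gr (j + d). X \<subseteq> H \<and> H \<subseteq> Y} = qint CARD('a) (Suc d)"
  using assms
proof (induction d arbitrary: X j)
  case 0
  then have "{H \<in> Gr j. X \<subseteq> H \<and> H \<subseteq> Y} = {X}"
    using Gr_eqI[of X j] by auto
  then show ?case by simp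
next
  case (Suc d)
  let ?q = "CARD('a)"
  let ?P = "{P \<in> Gr (Suc j). X \<subseteq> P \<and> P \<subseteq> Y}" and ?H = "{H \<in> Gr (j + Suc d). X \<subseteq> H \<and> H \<subseteq> Y}"
  have 1: "card {H \<in> ?H. P \<subseteq> H} = qint ?q (Suc d)" if "P \<in> ?P" for P
  proof -
    have "{H \<in> ?H. P \<subseteq> H} = {H \<in> Gr (Suc j + d). P \<subseteq> H \<and> H \<subseteq> Y}"
      using that by auto
    then show ?thesis using Suc.IH[of P "Suc j"] Suc.prems that by simp
  qed
  have 2: "card {P \<in> ?P. P \<subseteq> H} = qint ?q (Suc d)" if "H \<in> ?H" for H
  proof -
    have "{P \<in> ?P. P \<subseteq> H} = {P \<in> Gr (Suc j). X \<subseteq> P \<and> P \<subseteq> H}"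
      using that by auto
    then show ?thesis using card_covers[of X j H "j + Suc d"] Suc.prems that by simp
  qed
  have "(\<Sum>P\<in>?P. card {H \<in> ?H. P \<subseteq> H}) = (\<Sum>H\<in>?H. card {P \<in> ?P. P \<subseteq> H})"
    by (rule sum_card_swap) simp_all
  then have "card ?P * qint ?q (Suc d) = card ?H * qint ?q (Suc d)"
    using 1 2 by simp
  moreover have "card ?P = qint ?q (Suc (Suc d))"
    using card_covers[OF Suc.prems] by simp
  moreover have "qint ?q (Suc d) > 0"
    by (simp add: qint_pos)
  ultimately show ?case by simp
qed

text \<open>Adds the degenerate case \<open>X = Y\<close>, where no hyperplane exists and
  \<open>qint q 0 = 0\<close>. It occurs below with \<open>X = J \<inter> U\<close> when
  \<open>J\<close> lies in \<open>U\<close>.\<close>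

lemma card_hyperplanes_containing:
  fixes X Y :: "('a::{field,finite} ^ 'n) set"
  assumes "X \<in> Gr j" "Y \<in> Gr (Suc k)" "X \<subseteq> Y"
  shows "card {H \<in> Gr k. X \<subseteq> H \<and> H \<subseteq> Y} = qint CARD('a) (Suc k - j)"
proof (cases "j \<le> k")
  case True
  then show ?thesis
    using card_hyperplanes_containing_aux[of X j Y "k - j"] assms by (simp add: Suc_diff_le)
next
  case False
  then have "{H \<in> Gr k. X \<subseteq> H \<and> H \<subseteq> Y} = {}"
    using assms(1) Gr_dim_le by blast
  with False show ?thesis by (metis card.empty diff_is_0_eq not_less_eq_eq qint_0)
qed

lemma UNIV_Gr: "(UNIV :: ('a::field ^ 'n) set) \<in> Gr CARD('n)"
  by (rule GrI) (simp_all add: vec.dim_UNIV card_cart_basis)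

lemma Gr_dim_le_CARD: "U \<in> (Gr k :: ('a::field ^ 'n) set set) \<Longrightarrow> k \<le> CARD('n)"
  using Gr_dim_le[OF _ UNIV_Gr] by blast

lemma zero_in_Gr: "U \<in> Gr k \<Longrightarrow> 0 \<in> U"
  by (simp add: GrD vec.subspace_0)

section \<open>Subspaces that meet a given subspace trivially\<close>

lemma Gr_sum:
  assumes J: "J \<in> Gr j" and U: "U \<in> Gr u" and JU: "J \<inter> U = {0}"
  shows "{x + y |x y. x \<in> J \<and> y \<in> U} \<in> Gr (j + u)"
    "J \<subseteq> {x + y |x y. x \<in> J \<and> y \<in> U}" "U \<subseteq> {x + y |x y. x \<in> J \<and> y \<in> U}"
proof -
  show "{x + y |x y. x \<in> J \<and> y \<in> U} \<in> Gr (j + u)"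
    using vec.dim_sums_Int[OF GrD(1)[OF J] GrD(1)[OF U]] J U JU
    by (intro GrI vec.subspace_sums) (simp_all add: GrD)
  show "J \<subseteq> {x + y |x y. x \<in> J \<and> y \<in> U}"
    using zero_in_Gr[OF U] by force
  show "U \<subseteq> {x + y |x y. x \<in> J \<and> y \<in> U}"
    using zero_in_Gr[OF J] by force
qed

text \<open>A nonzero vector of \<open>J' \<inter> U\<close> generates \<open>J'\<close> over
  \<open>J\<close>, so \<open>J'\<close> lies in the sum. Conversely, removing the
  \<open>J\<close>-component from a vector of \<open>J'\<close> outside \<open>J\<close> leaves a
  nonzero vector of \<open>U\<close> in \<open>J'\<close>.\<close>

lemma cover_meets_iff:
  assumes J: "J \<in> Gr j" and U: "U \<in> Gr u" and JU: "J \<inter> U = {0}"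
    and J': "J' \<in> Gr (Suc j)" "J \<subseteq> J'"
  shows "J' \<inter> U \<noteq> {0} \<longleftrightarrow> J' \<subseteq> {x + y |x y. x \<in> J \<and> y \<in> U}" (is "_ \<longleftrightarrow> _ \<subseteq> ?JU")
proof
  assume "J' \<inter> U \<noteq> {0}"
  then obtain v where v: "v \<in> J'" "v \<in> U" "v \<noteq> 0"
    using zero_in_Gr[OF J'(1)] zero_in_Gr[OF U] by blast
  then have "J' = vec.span (insert v J)"
    using cover_eq_span_insert[OF J J'] JU by blast
  then show "J' \<subseteq> ?JU"
    using span_insert_subset[OF Gr_sum(1,2)[OF J U JU]] Gr_sum(3)[OF J U JU] v(2) by blast
next
  assume sub: "J' \<subseteq> ?JU"
  have "J \<noteq> J'"
    using J J' by (metis GrD(2) n_not_Suc_n)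
  then obtain v where v: "v \<in> J'" "v \<notin> J"
    using J'(2) by blast
  then obtain x y where xy: "v = x + y" "x \<in> J" "y \<in> U"
    using sub by blast
  have "v - x \<in> J'"
    using v(1) xy(2) J' by (meson GrD(1) subsetD vec.subspace_diff)
  moreover have "v - x = y" using xy(1) by simp
  moreover have "y \<noteq> 0" using v(2) xy by auto
  ultimately show "J' \<inter> U \<noteq> {0}" using xy(3) by auto
qed

text \<open>The number of \<open>r\<close>-spaces that contain a given \<open>j\<close>-space and meet a given \<open>u\<close>-space disjoint from it
  only in 0; see \<open>card_avoiding\<close>.\<close>

definition avoid_count :: "nat \<Rightarrow> nat \<Rightarrow> nat \<Rightarrow> nat \<Rightarrow> nat \<Rightarrow> real" where
  "avoid_count q n u r j = (\<Prod>i=j..<r. real (q ^ u * qint q (n - u - i)) / real (qint q (r - i)))"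

lemma avoid_count_self [simp]: "avoid_count q n u r r = 1"
  by (simp add: avoid_count_def)

text \<open>The factor for \<open>i = j\<close>, cleared of its denominator: the form in which the
  double count of \<open>card_avoiding\<close> produces it.\<close>

lemma avoid_count_step:
  assumes "j < r" "0 < q"
  shows "avoid_count q n u r j * qint q (r - j)
    = q ^ u * qint q (n - u - j) * avoid_count q n u r (Suc j)"
  using assms qint_pos[of q "r - j"]
  by (simp add: avoid_count_def prod.atLeast_Suc_lessThan)

text \<open>For \<open>i < r\<close> the index \<open>n - u - i\<close> is positive. Existence of
  subspaces in general position is later read off from this.\<close>

lemma avoid_count_pos:
  assumes "r + u \<le> n" "0 < q" shows "avoid_count q n u r j > 0"
  unfolding avoid_count_def using assms by (intro prod_pos) (auto intro!: divide_pos_pos mult_pos_pos qint_pos)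

text \<open>By \<open>cover_meets_iff\<close> the covers to discard are those inside the sum of
  \<open>J\<close> and \<open>U\<close>, which leaves [n - j] - [u]; \<open>qint_add\<close>
  evaluates the difference.\<close>

lemma card_covers_avoiding:
  fixes J U :: "('a::{field,finite} ^ 'n) set"
  assumes J: "J \<in> Gr j" and U: "U \<in> Gr u" and JU: "J \<inter> U = {0}"
  shows "card {J' \<in> Gr (Suc j). J \<subseteq> J' \<and> J' \<inter> U = {0}}
    = CARD('a) ^ u * qint CARD('a) (CARD('n) - u - j)"
proof -
  let ?JU = "{x + y |x y. x \<in> J \<and> y \<in> U}"
  note S = Gr_sum[OF J U JU]
  let ?A = "{J' \<in> Gr (Suc j). J \<subseteq> J' \<and> J' \<subseteq> UNIV}"
    and ?B = "{J' \<in> Gr (Suc j). J \<subseteq> J' \<and> J' \<subseteq> ?JU}"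
  have "j + u \<le> CARD('n)"
    using Gr_dim_le_CARD[OF S(1)] .
  then have n: "CARD('n) - j = u + (CARD('n) - u - j)" by simp
  have "{J' \<in> Gr (Suc j). J \<subseteq> J' \<and> J' \<inter> U = {0}} = ?A - ?B"
    using cover_meets_iff[OF J U JU] by auto
  then have "card {J' \<in> Gr (Suc j). J \<subseteq> J' \<and> J' \<inter> U = {0}} = card ?A - card ?B"
    by (simp add: card_Diff_subset Collect_mono_iff)
  also have "card ?A = qint CARD('a) (CARD('n) - j)"
    by (rule card_covers[OF J UNIV_Gr]) simp
  also have "card ?B = qint CARD('a) u"
    using card_covers[OF J S(1,2)] by simp
  finally show ?thesis
    unfolding n qint_add by simp
qed

text \<open>\<open>J\<close> is extended by one dimension at a time, counting pairs of a cover
  \<open>J'\<close> of \<open>J\<close> that avoids \<open>U\<close> and a space \<open>V\<close>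
  above \<open>J'\<close> that avoids \<open>U\<close>.\<close>

lemma card_avoiding:
  fixes J U :: "('a::{field,finite} ^ 'n) set"
  assumes "J \<in> Gr j" "U \<in> Gr u" "J \<inter> U = {0}" "j \<le> r"
  shows "real (card {V \<in> Gr r. J \<subseteq> V \<and> V \<inter> U = {0}}) = avoid_count CARD('a) CARD('n) u r j"
  using assms
proof (induction "r - j" arbitrary: J j)
  case 0
  then have "{V \<in> Gr r. J \<subseteq> V \<and> V \<inter> U = {0}} = {J}"
    using Gr_eqI[of J j] by auto
  then show ?case using 0 by simp
next
  case (Suc d)
  let ?q = "CARD('a)" and ?n = "CARD('n)"
  let ?A = "{J' \<in> Gr (Suc j). J \<subseteq> J' \<and> J' \<inter> U = {0}}"
  let ?B = "{V \<in> Gr r. J \<subseteq> V \<and> V \<inter> U = {0}}"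
  have jr: "j < r" using Suc.hyps(2) by simp
  have 1: "real (card {V \<in> ?B. J' \<subseteq> V}) = avoid_count ?q ?n u r (Suc j)" if "J' \<in> ?A" for J'
  proof -
    have "{V \<in> ?B. J' \<subseteq> V} = {V \<in> Gr r. J' \<subseteq> V \<and> V \<inter> U = {0}}"
      using that by auto
    then show ?thesis
      using Suc.hyps(1)[of "Suc j" J'] Suc.hyps(2) Suc.prems that by simp
  qed
  have 2: "card {J' \<in> ?A. J' \<subseteq> V} = qint ?q (r - j)" if "V \<in> ?B" for V
  proof -
    \<comment> \<open>A subspace of \<open>V\<close> avoids \<open>U\<close> because
      \<open>V\<close> does, so all covers of \<open>J\<close> inside \<open>V\<close>
      count.\<close>
    have "{J' \<in> ?A. J' \<subseteq> V} = {J' \<in> Gr (Suc j). J \<subseteq> J' \<and> J' \<subseteq> V}"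
      using that zero_in_Gr[OF Suc.prems(2)] by (auto dest: zero_in_Gr)
    then show ?thesis using card_covers[of J j V r] Suc.prems that by simp
  qed
  have "(\<Sum>J'\<in>?A. card {V \<in> ?B. J' \<subseteq> V}) = (\<Sum>V\<in>?B. card {J' \<in> ?A. J' \<subseteq> V})"
    by (rule sum_card_swap) simp_all
  then have "(\<Sum>J'\<in>?A. real (card {V \<in> ?B. J' \<subseteq> V})) = (\<Sum>V\<in>?B. real (card {J' \<in> ?A. J' \<subseteq> V}))"
    by (simp flip: of_nat_sum)
  then have "real (card ?A) * avoid_count ?q ?n u r (Suc j) = real (card ?B) * qint ?q (r - j)"
    using 1 2 by simp
  also have "card ?A = ?q ^ u * qint ?q (?n - u - j)"
    by (rule card_covers_avoiding[OF Suc.prems(1-3)])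
  finally have "real (card ?B) * qint ?q (r - j) = avoid_count ?q ?n u r j * qint ?q (r - j)"
    using avoid_count_step[OF jr, of ?q ?n u] by auto
  moreover have "qint ?q (r - j) > 0"
    using jr by (simp add: qint_pos)
  ultimately show ?case by simp
qed

section \<open>Harmonic functions and the spectrum of the q-Kneser graph\<close>

text \<open>If \<open>J \<inter> U\<close> is not inside the hyperplane \<open>I\<close>, the two
  together span \<open>J\<close>, and the dimension formula for sums gives a drop of exactly
  one.\<close>

lemma dim_hyperplane_Int:
  assumes J: "J \<in> Gr (Suc j)" and I: "I \<in> Gr j" "I \<subseteq> J" and U: "vec.subspace U"
  shows "vec.dim (J \<inter> U) = (if J \<inter> U \<subseteq> I then vec.dim (I \<inter> U) else Suc (vec.dim (I \<inter> U)))"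
proof (cases "J \<inter> U \<subseteq> I")
  case True
  then have "J \<inter> U = I \<inter> U" using I by auto
  then show ?thesis using True by simp
next
  case False
  let ?S = "{x + y |x y. x \<in> I \<and> y \<in> J \<inter> U}"
  have JU: "vec.subspace (J \<inter> U)"
    using GrD(1)[OF J] U by (rule vec.subspace_inter)
  have S: "vec.subspace ?S"
    using GrD(1)[OF I(1)] JU by (rule vec.subspace_sums)
  have "?S \<subseteq> J"
    using I(2) vec.subspace_add[OF GrD(1)[OF J]] by auto
  then have "vec.dim ?S \<le> Suc j"
    using vec.dim_subset[of ?S J] GrD(2)[OF J] by simp
  moreover have "I \<subseteq> ?S" "J \<inter> U \<subseteq> ?S"
    using vec.subspace_0[OF JU] zero_in_Gr[OF I(1)] by force+
  then have "\<not> vec.dim ?S \<le> j"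
    using vec.subspace_dim_equal[OF GrD(1)[OF I(1)] S] GrD(2)[OF I(1)] False by auto
  moreover have "I \<inter> (J \<inter> U) = I \<inter> U" using I(2) by auto
  ultimately show ?thesis
    using vec.dim_sums_Int[OF GrD(1)[OF I(1)] JU] GrD(2)[OF I(1)] False by simp
qed

text \<open>The kernel of the lowering operator from functions on \<open>j\<close>-spaces to
  functions on (j-1)-spaces. Writing \<open>j = Suc i\<close> makes the condition vacuous for
  \<open>j = 0\<close>.\<close>

definition harmonic :: "nat \<Rightarrow> (('a::{field,finite} ^ 'n) set \<Rightarrow> real) \<Rightarrow> bool" where
  "harmonic j h \<longleftrightarrow> (\<forall>i I. j = Suc i \<longrightarrow> I \<in> Gr i \<longrightarrow> (\<Sum>J\<in>{J \<in> Gr j. I \<subseteq> J}. h J) = 0)"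

text \<open>By \<open>dim_hyperplane_Int\<close>, passing from \<open>J\<close> to a hyperplane
  keeps the dimension of the intersection with \<open>U\<close> if the hyperplane contains
  \<open>J \<inter> U\<close> and lowers it by one otherwise. The two nonzero cases count the
  hyperplanes of these two kinds.\<close>

lemma card_hyperplanes_dim_Int:
  fixes J U :: "('a::{field,finite} ^ 'n) set"
  assumes J: "J \<in> Gr (Suc j)" and U: "vec.subspace U" and ij: "i \<le> j"
  shows "card {I \<in> Gr j. vec.dim (I \<inter> U) = i \<and> I \<subseteq> J}
    = (if vec.dim (J \<inter> U) = i then qint CARD('a) (Suc j - i)
       else if vec.dim (J \<inter> U) = Suc i then CARD('a) ^ (j - i) * qint CARD('a) (Suc i) else 0)"
    (is "card ?A = _")
proof -
  let ?q = "CARD('a)" and ?m = "vec.dim (J \<inter> U)"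
  let ?B = "{I \<in> Gr j. J \<inter> U \<subseteq> I \<and> I \<subseteq> J}" and ?C = "{I \<in> Gr j. I \<subseteq> J}"
  note d = dim_hyperplane_Int[OF J _ _ U]
  have X: "J \<inter> U \<in> Gr ?m"
    by (simp add: subspace_Gr vec.subspace_inter GrD(1)[OF J] U)
  have B: "card ?B = qint ?q (Suc j - ?m)"
    using card_hyperplanes_containing[OF X J] by simp
  have "?C = {I \<in> Gr j. {0} \<subseteq> I \<and> I \<subseteq> J}"
    by (auto dest: zero_in_Gr)
  then have C: "card ?C = qint ?q (Suc j)"
    using card_hyperplanes_containing[of "{0}" 0 J j] J zero_in_Gr[OF J] by (simp add: Gr_0)
  consider "?m = i" | "?m = Suc i" | "?m \<noteq> i" "?m \<noteq> Suc i" by blast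
  then show ?thesis
  proof cases
    case 1
    then have "?A = ?B" using d by (auto split: if_splits)
    then show ?thesis using 1 B by simp
  next
    case 2
    then have "vec.dim (I \<inter> U) = i \<longleftrightarrow> \<not> J \<inter> U \<subseteq> I" if "I \<in> ?C" for I
      using d[of I] that by (simp split: if_splits)
    then have "?A = ?C - ?B" by blast
    moreover have "?B \<subseteq> ?C" by blast
    ultimately have "card ?A = qint ?q (Suc j) - qint ?q (j - i)"
      using 2 B C by (simp add: card_Diff_subset)
    moreover have "qint ?q (Suc j) = qint ?q (j - i) + ?q ^ (j - i) * qint ?q (Suc i)"
      using qint_add[of ?q "j - i" "Suc i"] ij by simp
    ultimately show ?thesis using 2 by simp
  next
    case 3
    then have "vec.dim (I \<inter> U) \<noteq> i" if "I \<in> Gr j" "I \<subseteq> J" for I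
      using d[OF that] by (simp split: if_splits)
    then have "?A = {}" by blast
    then show ?thesis using 3 by (metis card.empty)
  qed
qed

text \<open>Sum the harmonicity condition over all \<open>I\<close> with
  \<open>vec.dim (I \<inter> U) = i\<close> and exchange the sums. Only those \<open>J\<close>
  contribute that meet \<open>U\<close> in dimension \<open>i\<close> or
  \<open>i + 1\<close>.\<close>

lemma harmonic_recursion:
  fixes h :: "('a::{field,finite} ^ 'n) set \<Rightarrow> real"
  assumes h: "harmonic (Suc j) h" and U: "vec.subspace U" and ij: "i \<le> j"
  shows "qint CARD('a) (Suc j - i) * (\<Sum>J\<in>{J \<in> Gr (Suc j). vec.dim (J \<inter> U) = i}. h J)
    = - (CARD('a) ^ (j - i) * qint CARD('a) (Suc i)
        * (\<Sum>J\<in>{J \<in> Gr (Suc j). vec.dim (J \<inter> U) = Suc i}. h J))"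
proof -
  let ?q = "CARD('a)" and ?m = "\<lambda>J. vec.dim (J \<inter> U)"
  let ?a = "real (qint ?q (Suc j - i))" and ?b = "real (?q ^ (j - i) * qint ?q (Suc i))"
  have "0 = (\<Sum>I\<in>{I \<in> Gr j. ?m I = i}. \<Sum>J\<in>{J \<in> Gr (Suc j). I \<subseteq> J}. h J)"
    using h by (simp add: harmonic_def)
  also have "\<dots> = (\<Sum>J\<in>Gr (Suc j). \<Sum>I\<in>{I \<in> {I \<in> Gr j. ?m I = i}. I \<subseteq> J}. h J)"
    by (rule sum.swap_restrict) simp_all
  also have "\<dots> = (\<Sum>J\<in>Gr (Suc j). real (card {I \<in> Gr j. ?m I = i \<and> I \<subseteq> J}) * h J)"
    by simp
  also have "\<dots> = (\<Sum>J\<in>Gr (Suc j). (if ?m J = i then ?a * h J else 0) + (if ?m J = Suc i then ?b * h J else 0))"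
    by (rule sum.cong) (simp_all add: card_hyperplanes_dim_Int[OF _ U ij])
  also have "\<dots> = ?a * (\<Sum>J\<in>{J \<in> Gr (Suc j). ?m J = i}. h J) + ?b * (\<Sum>J\<in>{J \<in> Gr (Suc j). ?m J = Suc i}. h J)"
    by (simp add: sum.distrib sum_distrib_left flip: sum.inter_filter)
  finally show ?thesis by simp
qed

text \<open>Iterating the recursion from \<open>i = 0\<close> to \<open>i = j\<close>, the q-integer factors cancel.\<close>

lemma harmonic_sum_disjoint:
  fixes h :: "('a::{field,finite} ^ 'n) set \<Rightarrow> real"
  assumes h: "harmonic j h" and U: "U \<in> Gr u"
  shows "(\<Sum>J\<in>{J \<in> Gr j. J \<inter> U = {0}}. h J)
    = (-1) ^ j * real CARD('a) ^ (\<Sum>t<j. t) * (\<Sum>J\<in>{J \<in> Gr j. J \<subseteq> U}. h J)"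
proof -
  let ?q = "CARD('a)"
  define F where "F i = (\<Sum>J\<in>{J \<in> Gr j. vec.dim (J \<inter> U) = i}. h J)" for i
  have step: "qint ?q (j - i) * F i = - (real ?q ^ (j - Suc i) * qint ?q (Suc i) * F (Suc i))"
    if "i < j" for i
  proof -
    obtain k where k: "j = Suc k" using \<open>i < j\<close> by (cases j) auto
    then show ?thesis
      using harmonic_recursion[of k h U i] h GrD(1)[OF U] \<open>i < j\<close> by (simp add: F_def)
  qed
  \<comment> \<open>The first \<open>i\<close> steps multiplied together, with the q-integers kept
    on both sides as products.\<close>
  have chain: "F 0 * (\<Prod>t<i. real (qint ?q (j - t)))
      = (-1) ^ i * real ?q ^ (\<Sum>t<i. j - Suc t) * (\<Prod>t<i. real (qint ?q (Suc t))) * F i" if "i \<le> j" for i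
    using that
  proof (induction i)
    case (Suc i)
    have "F 0 * (\<Prod>t<Suc i. real (qint ?q (j - t)))
      = (-1) ^ i * real ?q ^ (\<Sum>t<i. j - Suc t) * (\<Prod>t<i. real (qint ?q (Suc t))) * (qint ?q (j - i) * F i)"
      using Suc by simp
    also have "\<dots> = (-1) ^ Suc i * real ?q ^ (\<Sum>t<Suc i. j - Suc t) * (\<Prod>t<Suc i. real (qint ?q (Suc t))) * F (Suc i)"
      unfolding step[OF Suc_le_lessD[OF Suc.prems]] by (simp add: power_add)
    finally show ?case .
  qed simp
  \<comment> \<open>At \<open>i = j\<close> the two products have the same factors in opposite
    order.\<close>
  have "(\<Prod>t<j. real (qint ?q (j - t))) = (\<Prod>t<j. real (qint ?q (Suc (j - Suc t))))"
    by (rule prod.cong) (simp_all add: Suc_diff_Suc)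
  also have "\<dots> = (\<Prod>t<j. real (qint ?q (Suc t)))"
    by (rule prod.nat_diff_reindex)
  finally have P: "(\<Prod>t<j. real (qint ?q (j - t))) = (\<Prod>t<j. real (qint ?q (Suc t)))" .
  have S: "(\<Sum>t<j. j - Suc t) = (\<Sum>t<j. t)"
    by (rule sum.nat_diff_reindex)
  have "(\<Prod>t<j. real (qint ?q (Suc t))) > 0"
    by (intro prod_pos) (simp add: qint_pos)
  moreover have "F 0 * (\<Prod>t<j. real (qint ?q (Suc t)))
      = ((-1) ^ j * real ?q ^ (\<Sum>t<j. t) * F j) * (\<Prod>t<j. real (qint ?q (Suc t)))"
    using chain[of j] unfolding P S by (simp only: mult_ac order_refl simp_thms)
  ultimately have F: "F 0 = (-1) ^ j * real ?q ^ (\<Sum>t<j. t) * F j"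
    by (metis less_irrefl mult_right_cancel)
  have "{J \<in> Gr j. vec.dim (J \<inter> U) = 0} = {J \<in> Gr j. J \<inter> U = {0}}"
    using zero_in_Gr[OF U] by (auto dest: zero_in_Gr)
  moreover have "vec.dim (J \<inter> U) = j \<longleftrightarrow> J \<subseteq> U" if "J \<in> Gr j" for J
  proof
    assume "vec.dim (J \<inter> U) = j"
    then have "J \<inter> U \<in> Gr j"
      by (simp add: GrI vec.subspace_inter GrD(1)[OF that] GrD(1)[OF U])
    then show "J \<subseteq> U" using Gr_eqI[OF _ that, of "J \<inter> U"] by auto
  qed (use that GrD(2) in \<open>auto simp: Int_absorb2\<close>)
  then have "{J \<in> Gr j. vec.dim (J \<inter> U) = j} = {J \<in> Gr j. J \<subseteq> U}" by auto
  ultimately show ?thesis using F by (simp add: F_def)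
qed

section \<open>Eigenvectors and eigenvalues of the q-Kneser graph\<close>

text \<open>The raising operator. The dimension of \<open>U\<close> is left open, so that one
  function can be summed over subspaces of any size.\<close>

definition subsum :: "nat \<Rightarrow> (('a::{field,finite} ^ 'n) set \<Rightarrow> real) \<Rightarrow> ('a ^ 'n) set \<Rightarrow> real" where
  "subsum j h U = (\<Sum>J\<in>{J \<in> Gr j. J \<subseteq> U}. h J)"

lemma subsum_self: "U \<in> Gr r \<Longrightarrow> subsum r g U = g U"
proof -
  assume "U \<in> Gr r"
  then have "{J \<in> Gr r. J \<subseteq> U} = {U}" using Gr_eqI by auto
  then show ?thesis by (simp add: subsum_def)
qed

text \<open>After exchanging the sums, a \<open>J\<close> that meets \<open>U\<close> nontrivially
  lies in no admissible \<open>V\<close>, and every other \<open>J\<close> lies in equally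
  many.\<close>

lemma sum_subsum_disjoint:
  fixes h :: "('a::{field,finite} ^ 'n) set \<Rightarrow> real"
  assumes U: "U \<in> Gr u" and jr: "j \<le> r"
  shows "(\<Sum>V\<in>{V \<in> Gr r. V \<inter> U = {0}}. subsum j h V)
    = avoid_count CARD('a) CARD('n) u r j * (\<Sum>J\<in>{J \<in> Gr j. J \<inter> U = {0}}. h J)"
proof -
  let ?N = "avoid_count CARD('a) CARD('n) u r j"
  have N: "real (card {V \<in> Gr r. V \<inter> U = {0} \<and> J \<subseteq> V}) = (if J \<inter> U = {0} then ?N else 0)"
    if "J \<in> Gr j" for J
  proof (cases "J \<inter> U = {0}")
    case True
    then show ?thesis using card_avoiding[OF that U True jr] by (simp add: conj_commute)
  next
    case False
    then have "{V \<in> Gr r. V \<inter> U = {0} \<and> J \<subseteq> V} = {}"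
      using zero_in_Gr[OF U] zero_in_Gr[OF that] by auto
    then show ?thesis using False by (metis card.empty of_nat_0)
  qed
  have "(\<Sum>V\<in>{V \<in> Gr r. V \<inter> U = {0}}. subsum j h V)
      = (\<Sum>J\<in>Gr j. \<Sum>V\<in>{V \<in> {V \<in> Gr r. V \<inter> U = {0}}. J \<subseteq> V}. h J)"
    unfolding subsum_def by (rule sum.swap_restrict) simp_all
  also have "\<dots> = (\<Sum>J\<in>Gr j. real (card {V \<in> Gr r. V \<inter> U = {0} \<and> J \<subseteq> V}) * h J)"
    by simp
  also have "\<dots> = (\<Sum>J\<in>Gr j. if J \<inter> U = {0} then ?N * h J else 0)"
    using N by (intro sum.cong) auto
  also have "\<dots> = ?N * (\<Sum>J\<in>{J \<in> Gr j. J \<inter> U = {0}}. h J)"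
    by (simp add: sum_distrib_left flip: sum.inter_filter)
  finally show ?thesis .
qed

text \<open>The exponent is the binomial coefficient (j choose 2), and
  \<open>avoid_count q n r r j\<close> is q^(r(r-j)) times the Gaussian binomial of n-r-j over
  r-j.\<close>

definition kneser_eigenvalue :: "nat \<Rightarrow> nat \<Rightarrow> nat \<Rightarrow> nat \<Rightarrow> real" where
  "kneser_eigenvalue q n r j = (-1) ^ j * (real q ^ (\<Sum>t<j. t) * avoid_count q n r r j)"

text \<open>Summing over the neighbours of \<open>U\<close> yields a multiple of the sum of
  \<open>h\<close> over the \<open>J\<close> that avoid \<open>U\<close>; harmonicity turns this
  back into the sum over the \<open>J\<close> inside \<open>U\<close>.\<close>

lemma kneser_eigenvector:
  fixes h :: "('a::{field,finite} ^ 'n) set \<Rightarrow> real"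
  assumes "harmonic j h" "U \<in> Gr r" "j \<le> r"
  shows "(\<Sum>V\<in>{V \<in> Gr r. V \<inter> U = {0}}. subsum j h V)
    = kneser_eigenvalue CARD('a) CARD('n) r j * subsum j h U"
  unfolding sum_subsum_disjoint[OF assms(2,3)] harmonic_sum_disjoint[OF assms(1,2)]
  by (simp add: kneser_eigenvalue_def subsum_def)

text \<open>The ratio of consecutive absolute values is q^j [r-j] / (q^r [n-r-j]), which is below 1
  since \<open>n > 2 * r\<close>.\<close>

lemma abs_kneser_eigenvalue_step:
  assumes "j < r" "2 * r < n" "0 < q"
  shows "\<bar>kneser_eigenvalue q n r (Suc j)\<bar> < \<bar>kneser_eigenvalue q n r j\<bar>"
proof -
  let ?N = "avoid_count q n r r"
  have pos: "?N i > 0" for i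
    using assms by (intro avoid_count_pos) auto
  have "q ^ j * qint q (r - j) < q ^ r * qint q (n - r - j)"
    using assms by (intro mult_le_less_imp_less power_increasing qint_strict_mono) auto
  then have "real (q ^ j * qint q (r - j)) * ?N (Suc j) < real (q ^ r * qint q (n - r - j)) * ?N (Suc j)"
    using pos[of "Suc j"] by (simp only: of_nat_less_iff mult_less_cancel_right_pos)
  also have "\<dots> = ?N j * qint q (r - j)"
    using avoid_count_step[of j r q n r] assms by simp
  finally have "(real q ^ j * ?N (Suc j)) * qint q (r - j) < ?N j * qint q (r - j)"
    by (simp add: mult_ac)
  then have "real q ^ j * ?N (Suc j) < ?N j"
    by (simp add: mult_less_cancel_right)
  then have "real q ^ (\<Sum>t<j. t) * (real q ^ j * ?N (Suc j)) < real q ^ (\<Sum>t<j. t) * ?N j"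
    using assms by (intro mult_strict_left_mono) auto
  then show ?thesis
    using pos[of j] pos[of "Suc j"] by (simp add: kneser_eigenvalue_def abs_mult power_add mult_ac)
qed

text \<open>It makes the eigenvalues distinct and, as the one of index 1 is negative, makes that one
  the strict minimum.\<close>

lemma abs_kneser_eigenvalue_less:
  assumes "i < j" "j \<le> r" "2 * r < n" "0 < q"
  shows "\<bar>kneser_eigenvalue q n r j\<bar> < \<bar>kneser_eigenvalue q n r i\<bar>"
  using assms
proof (induction j)
  case (Suc j)
  then show ?case using abs_kneser_eigenvalue_step[of j r n q] by (cases "i = j") auto
qed simp

section \<open>Decomposition into lifts of harmonic functions\<close>

text \<open>\<open>g\<close> is projected orthogonally onto the span of the incidence vectors of
  \<open>B\<close>, and \<open>h\<close> is the remainder. Vectors are indexed by the whole type, so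
  incidence is cut off outside \<open>A\<close>.\<close>

lemma orthogonal_incidence_decomposition:
  fixes R :: "'b \<Rightarrow> 'x::finite \<Rightarrow> bool" and g :: "'x \<Rightarrow> real"
  assumes "finite B"
  obtains h g' where "\<And>x. x \<in> A \<Longrightarrow> g x = h x + (\<Sum>b\<in>{b \<in> B. R b x}. g' b)"
    and "\<And>b. b \<in> B \<Longrightarrow> (\<Sum>x\<in>{x \<in> A. R b x}. h x) = 0"
proof -
  define w :: "'b \<Rightarrow> real ^ 'x" where "w b = (\<chi> x. if x \<in> A \<and> R b x then 1 else 0)" for b
  obtain y z where y: "y \<in> span (w ` B)" and z: "\<And>v. v \<in> span (w ` B) \<Longrightarrow> orthogonal z v"
    and g: "(\<chi> x. g x) = y + z"
    using orthogonal_subspace_decomp_exists[of "w ` B" "\<chi> x. g x"] by metis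
  \<comment> \<open>The coefficients are indexed by \<open>B\<close> instead of by vectors, as
    \<open>w\<close> may fail to be injective.\<close>
  have "\<exists>c. y = (\<Sum>b\<in>B. c b *\<^sub>R w b)"
    using y
  proof (induction rule: span_induct_alt)
    case base
    show ?case by (rule exI[of _ "\<lambda>_. 0"]) simp
  next
    case (step c v u)
    then obtain b d where b: "b \<in> B" "v = w b" and d: "u = (\<Sum>b\<in>B. d b *\<^sub>R w b)" by auto
    have "(\<Sum>x\<in>B. (d x + (if x = b then c else 0)) *\<^sub>R w x)
      = (\<Sum>x\<in>B. d x *\<^sub>R w x) + (\<Sum>x\<in>B. if x = b then c *\<^sub>R w x else 0)"
      unfolding sum.distrib[symmetric] by (rule sum.cong) (auto simp: algebra_simps)
    also have "\<dots> = c *\<^sub>R v + u"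
      using b d assms by simp
    finally show ?case by metis
  qed
  then obtain g' where g': "y = (\<Sum>b\<in>B. g' b *\<^sub>R w b)" ..
  show thesis
  proof
    fix x assume "x \<in> A"
    have "g x = z $ x + y $ x"
      using arg_cong[OF g, of "\<lambda>v. v $ x"] by simp
    also have "y $ x = (\<Sum>b\<in>B. if R b x then g' b else 0)"
      unfolding g' using \<open>x \<in> A\<close> by (auto simp: w_def intro!: sum.cong)
    finally show "g x = z $ x + (\<Sum>b\<in>{b \<in> B. R b x}. g' b)"
      using assms by (simp add: sum.inter_filter)
  next
    fix b assume "b \<in> B"
    then have "z \<bullet> w b = 0"
      using z[of "w b"] by (simp add: span_base orthogonal_def)
    then have "(\<Sum>x\<in>UNIV. if x \<in> A \<and> R b x then z $ x else 0) = 0"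
      by (simp add: inner_vec_def w_def if_distrib cong: if_cong)
    then show "(\<Sum>x\<in>{x \<in> A. R b x}. z $ x) = 0"
      by (simp flip: sum.inter_filter)
  qed
qed

text \<open>A function on (k+1)-spaces is a harmonic one plus the lift of some \<open>g'\<close>
  from \<open>k\<close>-spaces. Lifting \<open>g'\<close> further to \<open>U\<close> passes each
  \<open>I\<close> through the [r-k] covers of \<open>I\<close> inside \<open>U\<close>, so the
  second part is the direct lift of [r-k] \<open>g'\<close>, to which induction applies.\<close>

lemma subsum_harmonic_decomposition:
  fixes g :: "('a::{field,finite} ^ 'n) set \<Rightarrow> real"
  assumes "k \<le> r"
  shows "\<exists>h. (\<forall>j\<le>k. harmonic j (h j)) \<and> (\<forall>U\<in>Gr r. subsum k g U = (\<Sum>j\<le>k. subsum j (h j) U))"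
  using assms
proof (induction k arbitrary: g)
  case 0
  show ?case by (rule exI[of _ "\<lambda>_. g"]) (simp add: harmonic_def)
next
  case (Suc k)
  let ?q = "CARD('a)"
  obtain h0 g' where g: "\<And>J. J \<in> Gr (Suc k) \<Longrightarrow> g J = h0 J + (\<Sum>I\<in>{I \<in> Gr k. I \<subseteq> J}. g' I)"
    and h0: "\<And>I. I \<in> Gr k \<Longrightarrow> (\<Sum>J\<in>{J \<in> Gr (Suc k). I \<subseteq> J}. h0 J) = 0"
    by (rule orthogonal_incidence_decomposition[of "Gr k" "Gr (Suc k)" g "(\<subseteq>)"]) (simp, blast)
  obtain h where h: "\<forall>j\<le>k. harmonic j (h j)"
    and dec: "\<forall>U\<in>Gr r. subsum k (\<lambda>I. qint ?q (r - k) * g' I) U = (\<Sum>j\<le>k. subsum j (h j) U)"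
    using Suc.IH[of "\<lambda>I. qint ?q (r - k) * g' I"] Suc.prems by auto
  have "subsum (Suc k) g U = subsum (Suc k) h0 U + (\<Sum>j\<le>k. subsum j (h j) U)" if U: "U \<in> Gr r" for U
  proof -
    have "subsum (Suc k) g U
      = subsum (Suc k) h0 U + (\<Sum>J\<in>{J \<in> Gr (Suc k). J \<subseteq> U}. \<Sum>I\<in>{I \<in> Gr k. I \<subseteq> J}. g' I)"
      by (simp add: subsum_def g sum.distrib)
    also have "(\<Sum>J\<in>{J \<in> Gr (Suc k). J \<subseteq> U}. \<Sum>I\<in>{I \<in> Gr k. I \<subseteq> J}. g' I)
      = (\<Sum>I\<in>Gr k. \<Sum>J\<in>{J \<in> {J \<in> Gr (Suc k). J \<subseteq> U}. I \<subseteq> J}. g' I)"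
      by (rule sum.swap_restrict) simp_all
    also have "\<dots> = (\<Sum>I\<in>Gr k. real (card {J \<in> Gr (Suc k). I \<subseteq> J \<and> J \<subseteq> U}) * g' I)"
      by (simp add: conj_ac)
    also have "\<dots> = (\<Sum>I\<in>Gr k. if I \<subseteq> U then qint ?q (r - k) * g' I else 0)"
    proof (rule sum.cong[OF refl])
      fix I :: "('a ^ 'n) set" assume I: "I \<in> Gr k"
      show "real (card {J \<in> Gr (Suc k). I \<subseteq> J \<and> J \<subseteq> U}) * g' I = (if I \<subseteq> U then qint ?q (r - k) * g' I else 0)"
      proof (cases "I \<subseteq> U")
        case False
        then have "{J \<in> Gr (Suc k). I \<subseteq> J \<and> J \<subseteq> U} = {}" by auto
        then show ?thesis using False by (metis card.empty mult_zero_left of_nat_0)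
      qed (use card_covers[OF I U] in simp)
    qed
    also have "\<dots> = subsum k (\<lambda>I. qint ?q (r - k) * g' I) U"
      by (simp add: subsum_def sum.inter_filter)
    finally show ?thesis using dec U by simp
  qed
  then have "\<forall>U\<in>Gr r. subsum (Suc k) g U = (\<Sum>j\<le>Suc k. subsum j ((h(Suc k := h0)) j) U)"
    by simp
  moreover have "\<forall>j\<le>Suc k. harmonic j ((h(Suc k := h0)) j)"
    using h h0 by (auto simp: le_Suc_eq harmonic_def)
  ultimately show ?case by blast
qed

section \<open>The ratio bound\<close>

text \<open>Hoffman's argument. With \<open>nrm j\<close> the squared norm of the component
  \<open>g j\<close>, independence gives \<Sum> \<open>lam j * nrm j\<close> = 0, while \<Sum>
  \<open>nrm j\<close> = |S| and \<open>nrm 0\<close> = |S|^2 / |X|. Adding \<open>b\<close> times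
  the second equation to the first makes all terms with \<open>j \<ge> 1\<close> nonnegative, which
  is the bound; equality forces each of these terms to be 0.\<close>

lemma ratio_bound:
  fixes g :: "nat \<Rightarrow> 'v \<Rightarrow> real" and lam :: "nat \<Rightarrow> real" and b c :: real
  assumes fin: "finite X" and ne: "X \<noteq> {}" and S: "S \<subseteq> X"
    and sym: "\<And>U V. E U V \<Longrightarrow> E V U"
    and indep: "\<And>U V. U \<in> S \<Longrightarrow> V \<in> S \<Longrightarrow> \<not> E U V"
    and dec: "\<And>U. U \<in> X \<Longrightarrow> indicator S U = (\<Sum>j\<le>r. g j U)"
    and eig: "\<And>j U. j \<le> r \<Longrightarrow> U \<in> X \<Longrightarrow> (\<Sum>V\<in>{V \<in> X. E V U}. g j V) = lam j * g j U"
    and reg: "\<And>U. U \<in> X \<Longrightarrow> real (card {V \<in> X. E V U}) = lam 0"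
    and g0: "\<And>U. U \<in> X \<Longrightarrow> g 0 U = c"
    and inj: "inj_on lam {..r}"
    and low: "\<And>j. 1 \<le> j \<Longrightarrow> j \<le> r \<Longrightarrow> - b \<le> lam j" and b: "0 \<le> b"
  shows "card S * (lam 0 + b) \<le> b * card X"
    and "card S * (lam 0 + b) = b * card X \<Longrightarrow> 1 \<le> j \<Longrightarrow> j \<le> r \<Longrightarrow> - b < lam j \<Longrightarrow> U \<in> X
      \<Longrightarrow> g j U = 0"
proof -
  define nrm where "nrm j = (\<Sum>U\<in>X. g j U * g j U)" for j
  \<comment> \<open>The neighbour sum is a self-adjoint operator, so its eigenfunctions for distinct
    eigenvalues are orthogonal.\<close>
  have adj: "(\<Sum>U\<in>X. f U * (\<Sum>V\<in>{V \<in> X. E V U}. f' V)) = (\<Sum>V\<in>X. (\<Sum>U\<in>{U \<in> X. E U V}. f U) * f' V)"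
    for f f' :: "'v \<Rightarrow> real"
  proof -
    have "(\<Sum>U\<in>X. f U * (\<Sum>V\<in>{V \<in> X. E V U}. f' V)) = (\<Sum>U\<in>X. \<Sum>V\<in>{V \<in> X. E V U}. f U * f' V)"
      by (simp add: sum_distrib_left)
    also have "\<dots> = (\<Sum>V\<in>X. \<Sum>U\<in>{U \<in> X. E V U}. f U * f' V)"
      using fin by (intro sum.swap_restrict)
    also have "\<dots> = (\<Sum>V\<in>X. (\<Sum>U\<in>{U \<in> X. E U V}. f U) * f' V)"
      unfolding sum_distrib_right using sym by (intro sum.cong refl) auto
    finally show ?thesis .
  qed
  have orth: "(\<Sum>U\<in>X. g i U * g j U) = 0" if "i \<le> r" "j \<le> r" "i \<noteq> j" for i j
  proof -
    have "lam j * (\<Sum>U\<in>X. g i U * g j U) = (\<Sum>U\<in>X. g i U * (\<Sum>V\<in>{V \<in> X. E V U}. g j V))"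
      using that by (simp add: eig sum_distrib_left mult_ac)
    also have "\<dots> = (\<Sum>V\<in>X. (\<Sum>U\<in>{U \<in> X. E U V}. g i U) * g j V)"
      by (rule adj)
    also have "\<dots> = lam i * (\<Sum>U\<in>X. g i U * g j U)"
      using that by (simp add: eig sum_distrib_left mult_ac)
    finally show ?thesis
      using inj_onD[OF inj, of i j] that by auto
  qed
  \<comment> \<open>Regularity makes the constant 1 an eigenfunction for \<open>lam 0\<close>. It
    takes the place of \<open>g 0\<close>, whose value \<open>c\<close> may be 0.\<close>
  have orth1: "(\<Sum>U\<in>X. g j U) = 0" if "1 \<le> j" "j \<le> r" for j
  proof -
    have "lam 0 * (\<Sum>U\<in>X. g j U) = (\<Sum>U\<in>X. (\<Sum>V\<in>{V \<in> X. E V U}. 1) * g j U)"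
      by (simp add: reg sum_distrib_left)
    also have "\<dots> = (\<Sum>U\<in>X. 1 * (\<Sum>V\<in>{V \<in> X. E V U}. g j V))"
      by (rule adj[symmetric])
    also have "\<dots> = lam j * (\<Sum>U\<in>X. g j U)"
      using that by (simp add: eig sum_distrib_left)
    finally show ?thesis
      using inj_onD[OF inj, of 0 j] that by auto
  qed
  have split0: "(\<Sum>j\<le>r. f j) = f 0 + (\<Sum>j=1..r. f j)" for f :: "nat \<Rightarrow> real"
    by (simp add: atMost_atLeast0 sum.atLeast_Suc_atMost)
  \<comment> \<open>Used for \<open>m = 1\<close>, the squared norm of the indicator, and for
    \<open>m = lam\<close>, its quadratic form under adjacency.\<close>
  have quad: "(\<Sum>U\<in>X. (\<Sum>i\<le>r. g i U) * (\<Sum>j\<le>r. m j * g j U)) = (\<Sum>j\<le>r. m j * nrm j)" for m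
  proof -
    have "(\<Sum>U\<in>X. (\<Sum>i\<le>r. g i U) * (\<Sum>j\<le>r. m j * g j U))
      = (\<Sum>U\<in>X. \<Sum>j\<le>r. \<Sum>i\<le>r. m j * (g i U * g j U))"
      unfolding sum_product by (rule sum.cong[OF refl], subst sum.swap) (simp add: mult_ac)
    also have "\<dots> = (\<Sum>j\<le>r. \<Sum>U\<in>X. \<Sum>i\<le>r. m j * (g i U * g j U))"
      by (rule sum.swap)
    also have "\<dots> = (\<Sum>j\<le>r. \<Sum>i\<le>r. \<Sum>U\<in>X. m j * (g i U * g j U))"
      by (intro sum.cong refl sum.swap)
    also have "\<dots> = (\<Sum>j\<le>r. \<Sum>i\<le>r. if i = j then m j * nrm j else 0)"
      by (intro sum.cong refl) (auto simp: nrm_def orth simp flip: sum_distrib_left)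
    finally show ?thesis by simp
  qed
  have ind: "(\<Sum>U\<in>X. indicator S U) = real (card S)"
    using fin S by (simp add: indicator_def sum_of_bool_eq Int_absorb1)
  have card_S: "real (card S) = c * card X"
  proof -
    have "real (card S) = (\<Sum>U\<in>X. indicator S U)"
      using ind by simp
    also have "\<dots> = (\<Sum>j\<le>r. \<Sum>U\<in>X. g j U)"
      by (simp add: dec sum.swap[of _ X])
    finally show ?thesis by (simp add: split0 orth1 g0)
  qed
  have nrm0: "nrm 0 * card X = real (card S) * card S"
    unfolding card_S by (simp add: nrm_def g0)
  have total: "(\<Sum>j\<le>r. nrm j) = card S"
  proof -
    have "(\<Sum>j\<le>r. nrm j) = (\<Sum>U\<in>X. indicator S U * indicator S U)"
      using quad[of "\<lambda>_. 1"] by (simp add: dec)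
    also have "\<dots> = card S"
      using ind by (simp flip: indicator_inter_arith)
    finally show ?thesis .
  qed
  \<comment> \<open>The quadratic form counts the adjacent ordered pairs within
    \<open>S\<close>.\<close>
  have zero: "(\<Sum>j\<le>r. lam j * nrm j) = 0"
  proof -
    have "(\<Sum>j\<le>r. lam j * nrm j) = (\<Sum>U\<in>X. (\<Sum>i\<le>r. g i U) * (\<Sum>j\<le>r. \<Sum>V\<in>{V \<in> X. E V U}. g j V))"
      using quad[of lam] by (simp add: eig)
    also have "\<dots> = (\<Sum>U\<in>X. indicator S U * (\<Sum>V\<in>{V \<in> X. E V U}. indicator S V))"
      by (simp add: dec sum.swap[of _ "{..r}"])
    also have "\<dots> = 0"
    proof (intro sum.neutral ballI)
      fix U assume "U \<in> X"
      have "(\<Sum>V\<in>{V \<in> X. E V U}. indicator S V) = (0::real)" if "U \<in> S"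
        using indep that by (intro sum.neutral) (auto simp: indicator_def)
      then show "indicator S U * (\<Sum>V\<in>{V \<in> X. E V U}. indicator S V) = (0::real)"
        by (auto simp: indicator_def)
    qed
    finally show ?thesis .
  qed
  have rest: "(\<Sum>j=1..r. (lam j + b) * nrm j) = b * card S - (lam 0 + b) * nrm 0"
  proof -
    have "(\<Sum>j\<le>r. (lam j + b) * nrm j) = b * card S"
      using zero total by (simp add: distrib_right sum.distrib flip: sum_distrib_left)
    then show ?thesis by (simp add: split0)
  qed
  have nrm_nonneg: "nrm j \<ge> 0" for j
    by (simp add: nrm_def sum_nonneg)
  have nonneg: "(lam j + b) * nrm j \<ge> 0" if "j \<in> {1..r}" for j
    using low[of j] that nrm_nonneg by (intro mult_nonneg_nonneg) auto
  have X: "real (card X) > 0"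
    using fin ne by (simp add: card_gt_0_iff)
  show "card S * (lam 0 + b) \<le> b * card X"
  proof (cases "card S = 0")
    case False
    have "(lam 0 + b) * nrm 0 \<le> b * card S"
      using sum_nonneg[of "{1..r}" "\<lambda>j. (lam j + b) * nrm j"] nonneg rest by simp
    then have "(lam 0 + b) * (nrm 0 * card X) \<le> b * card S * card X"
      using X by (metis mult.assoc mult_right_mono less_imp_le)
    then have "real (card S) * (card S * (lam 0 + b)) \<le> card S * (b * card X)"
      unfolding nrm0 by (simp only: mult_ac)
    then show ?thesis using False by simp
  qed (use b in simp)
  show "g j U = 0" if eq: "card S * (lam 0 + b) = b * card X"
    and j: "1 \<le> j" "j \<le> r" "- b < lam j" and U: "U \<in> X"
  proof -
    have "(lam 0 + b) * (nrm 0 * card X) = b * card S * card X"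
      unfolding nrm0 using eq by algebra
    then have "(\<Sum>j=1..r. (lam j + b) * nrm j) = 0"
      unfolding rest using X by simp
    then have "(lam j + b) * nrm j = 0"
      using sum_nonneg_eq_0_iff[of "{1..r}" "\<lambda>j. (lam j + b) * nrm j"] nonneg j by force
    then have "nrm j = 0" using j by auto
    then show ?thesis
      using sum_nonneg_eq_0_iff[of X "\<lambda>U. g j U * g j U"] fin U by (simp add: nrm_def)
  qed
qed

section \<open>Stars and the Erdos-Ko-Rado bound\<close>

text \<open>Every subspace meets {0} trivially, so this is \<open>card_avoiding\<close> with
  \<open>u = 0\<close>.\<close>

lemma card_star:
  fixes p :: "('a::{field,finite} ^ 'n) set"
  assumes "p \<in> Gr j" "j \<le> r"
  shows "real (card {U \<in> Gr r. p \<subseteq> U}) = avoid_count CARD('a) CARD('n) 0 r j"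
proof -
  have "p \<inter> {0} = {0}" using zero_in_Gr[OF assms(1)] by auto
  moreover have "{U \<in> Gr r. p \<subseteq> U \<and> U \<inter> {0} = {0}} = {U \<in> Gr r. p \<subseteq> U}"
    by (auto dest: zero_in_Gr)
  ultimately show ?thesis
    using card_avoiding[OF assms(1) _ _ assms(2), of "{0}" 0] by (simp add: Gr_0)
qed

lemma card_Gr: "real (card (Gr r :: ('a::{field,finite} ^ 'n) set set)) = avoid_count CARD('a) CARD('n) 0 r 0"
proof -
  have "{U \<in> Gr r. {0} \<subseteq> U} = (Gr r :: ('a ^ 'n) set set)" by (auto dest: zero_in_Gr)
  then show ?thesis using card_star[of "{0::'a^'n}" 0 r] by (simp add: Gr_0)
qed

text \<open>Point stars have density [r] / [n], the value in the bound below; all these statements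
  are cross-multiplied.\<close>

lemma card_star_point:
  fixes p :: "('a::{field,finite} ^ 'n) set"
  assumes "p \<in> Gr 1" "1 \<le> r"
  shows "real (card {U \<in> Gr r. p \<subseteq> U}) * qint CARD('a) CARD('n)
    = real (card (Gr r :: ('a ^ 'n) set set)) * qint CARD('a) r"
  unfolding card_star[OF assms] card_Gr using avoid_count_step[of 0 r "CARD('a)" "CARD('n)" 0] assms(2)
  by simp

lemma card_points:
  fixes U :: "('a::{field,finite} ^ 'n) set"
  assumes "U \<in> Gr k"
  shows "card {p \<in> Gr 1. p \<subseteq> U} = qint CARD('a) k"
proof -
  have "{p \<in> Gr 1. p \<subseteq> U} = {p \<in> Gr (Suc 0). {0} \<subseteq> p \<and> p \<subseteq> U}"
    by (auto dest: zero_in_Gr)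
  then show ?thesis
    using card_covers[of "{0}" 0 U k] assms zero_in_Gr[OF assms] by (simp add: Gr_0)
qed

lemma Gr_nonempty:
  assumes "r \<le> CARD('n)" shows "(Gr r :: ('a::{field,finite} ^ 'n) set set) \<noteq> {}"
proof
  assume "(Gr r :: ('a ^ 'n) set set) = {}"
  then have "avoid_count CARD('a) CARD('n) 0 r 0 = 0"
    using card_Gr[of r, where ?'a = 'a and ?'n = 'n] by simp
  moreover have "avoid_count CARD('a) CARD('n) 0 r 0 > 0"
    using assms by (intro avoid_count_pos) auto
  ultimately show False by simp
qed

text \<open>\<open>ratio_bound\<close> for the q-Kneser graph with \<open>b = - lam 1\<close>. As
  \<open>lam 1\<close> is the strict minimum, equality leaves only the components 0 and 1, both
  expressible by points.\<close>

lemma intersecting_family: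
  fixes S :: "('a::{field,finite} ^ 'n) set set"
  assumes r: "1 \<le> r" "2 * r < CARD('n)" and S: "S \<subseteq> Gr r"
    and int: "\<And>U V. U \<in> S \<Longrightarrow> V \<in> S \<Longrightarrow> U \<inter> V \<noteq> {0}"
  shows "card S * qint CARD('a) CARD('n) \<le> card (Gr r :: ('a ^ 'n) set set) * qint CARD('a) r"
    and "card S * qint CARD('a) CARD('n) = card (Gr r :: ('a ^ 'n) set set) * qint CARD('a) r
      \<Longrightarrow> \<exists>a. \<forall>U\<in>Gr r. subsum 1 a U = indicator S U"
proof -
  let ?q = "CARD('a)" and ?n = "CARD('n)" and ?X = "Gr r :: ('a ^ 'n) set set"
  define lam where "lam = kneser_eigenvalue ?q ?n r"
  let ?N = "avoid_count ?q ?n r r"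
  obtain h :: "nat \<Rightarrow> ('a ^ 'n) set \<Rightarrow> real" where h: "\<forall>j\<le>r. harmonic j (h j)"
    and h_dec: "\<forall>U\<in>?X. subsum r (indicator S) U = (\<Sum>j\<le>r. subsum j (h j) U)"
    using subsum_harmonic_decomposition[of r r "indicator S"] by auto
  have dec: "indicator S U = (\<Sum>j\<le>r. subsum j (h j) U)" if "U \<in> ?X" for U
    using h_dec that by (simp add: subsum_self)
  have N_pos: "?N j > 0" for j
    using r by (intro avoid_count_pos) auto
  have lam0: "lam 0 = ?N 0" and lam1: "lam 1 = - ?N 1"
    by (simp_all add: lam_def kneser_eigenvalue_def)
  have less: "\<bar>lam j\<bar> < \<bar>lam i\<bar>" if "i < j" "j \<le> r" for i j
    unfolding lam_def using that r(2) by (intro abs_kneser_eigenvalue_less) auto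
  have lam_inj: "inj_on lam {..r}"
    by (rule linorder_inj_onI) (use less in fastforce)+
  have low': "- ?N 1 < lam j" if "2 \<le> j" "j \<le> r" for j
    using less[of 1 j] that lam1 N_pos[of 1] by simp
  have low: "- ?N 1 \<le> lam j" if "1 \<le> j" "j \<le> r" for j
    using low'[of j] lam1 that by (cases "j = 1") auto
  have g0: "subsum 0 (h 0) U = h 0 {0}" if "U \<in> ?X" for U
  proof -
    have "{J. J = {0} \<and> J \<subseteq> U} = {{0}}" using zero_in_Gr[OF that] by auto
    then show ?thesis by (simp add: subsum_def Gr_0)
  qed
  have reg: "real (card {V \<in> ?X. V \<inter> U = {0}}) = lam 0" if "U \<in> ?X" for U
  proof -
    have "{V \<in> ?X. {0} \<subseteq> V \<and> V \<inter> U = {0}} = {V \<in> ?X. V \<inter> U = {0}}"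
      by (auto dest: zero_in_Gr)
    then show ?thesis
      using card_avoiding[of "{0}" 0 U r r] that zero_in_Gr[OF that] by (simp add: Gr_0 lam0)
  qed
  \<comment> \<open>One recursion step relates \<open>?N 0\<close> to \<open>?N 1\<close> and turns
    Hoffman's ratio into [r] / [n].\<close>
  have ratio: "(lam 0 + ?N 1) * qint ?q r = ?N 1 * qint ?q ?n"
  proof -
    have "?N 0 * qint ?q r = ?q ^ r * qint ?q (?n - r) * ?N 1"
      using avoid_count_step[of 0 r ?q ?n r] r by simp
    moreover have "qint ?q ?n = qint ?q r + ?q ^ r * qint ?q (?n - r)"
      using qint_add[of ?q r "?n - r"] r by simp
    ultimately show ?thesis by (simp add: lam0 algebra_simps)
  qed
  have qr: "real (qint ?q r) > 0" using r by (simp add: qint_pos)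
  have iff: "(real (card S) * (lam 0 + ?N 1)) * qint ?q r = (card S * qint ?q ?n) * ?N 1"
    using ratio by (simp add: mult_ac)
  note bound = ratio_bound[where X = ?X and S = S and E = "\<lambda>U V. U \<inter> V = {0}" and r = r
    and g = "\<lambda>j. subsum j (h j)" and lam = lam and c = "h 0 {0}" and b = "?N 1"]
  have eig: "(\<Sum>V\<in>{V \<in> ?X. V \<inter> U = {0}}. subsum j (h j) V) = lam j * subsum j (h j) U"
    if "j \<le> r" "U \<in> ?X" for j U
    using h that by (simp add: kneser_eigenvector lam_def)
  have ne: "?X \<noteq> {}" using r by (intro Gr_nonempty) auto
  note prems = finite[of ?X] ne S _ int dec eig reg g0 lam_inj low less_imp_le[OF N_pos]
  have "card S * (lam 0 + ?N 1) \<le> ?N 1 * card ?X"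
    by (rule bound(1)) (use prems in \<open>auto simp: Int_commute\<close>)
  then have "(card S * (lam 0 + ?N 1)) * qint ?q r \<le> (?N 1 * card ?X) * qint ?q r"
    using qr by simp
  then have "(card S * qint ?q ?n) * ?N 1 \<le> (card ?X * qint ?q r) * ?N 1"
    unfolding iff by (simp only: of_nat_mult mult_ac)
  then have "real (card S * qint ?q ?n) \<le> real (card ?X * qint ?q r)"
    using N_pos[of 1] by simp
  then show "card S * qint ?q ?n \<le> card ?X * qint ?q r"
    by (simp only: of_nat_le_iff)
  show "\<exists>a. \<forall>U\<in>Gr r. subsum 1 a U = indicator S U" if eq: "card S * qint ?q ?n = card ?X * qint ?q r"
  proof -
    have "(real (card S) * (lam 0 + ?N 1)) * qint ?q r = (?N 1 * card ?X) * qint ?q r"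
      unfolding iff eq by simp
    then have eq': "card S * (lam 0 + ?N 1) = ?N 1 * card ?X"
      using qr by simp
    have zero: "subsum j (h j) U = 0" if "2 \<le> j" "j \<le> r" "U \<in> ?X" for j U
      by (rule bound(2)) (use prems eq' that low' in \<open>auto simp: Int_commute\<close>)
    \<comment> \<open>The constant component is spread evenly over the [r] points of
      \<open>U\<close>.\<close>
    have "subsum 1 (\<lambda>p. h 1 p + h 0 {0} / qint ?q r) U = indicator S U" if U: "U \<in> ?X" for U
    proof -
      have "{..r} = {0, 1} \<union> {2..r}" using r by auto
      then have "indicator S U = (\<Sum>j\<in>{0, 1}. subsum j (h j) U) + (\<Sum>j=2..r. subsum j (h j) U)"
        unfolding dec[OF U] by (simp add: sum.union_disjoint)
      also have "\<dots> = h 0 {0} + subsum 1 (h 1) U"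
        using zero U g0[OF U] by simp
      finally show ?thesis
        using qr card_points[OF U] by (simp add: subsum_def sum.distrib)
    qed
    then show ?thesis by blast
  qed
qed

section \<open>Uniqueness of extremal intersecting families\<close>

lemma point_avoids_iff:
  assumes p: "p \<in> Gr 1" and K: "vec.subspace K"
  shows "p \<inter> K = {0} \<longleftrightarrow> \<not> p \<subseteq> K"
proof
  assume "p \<inter> K = {0}"
  moreover have "p \<noteq> {0}" using GrD(2)[OF p] by auto
  ultimately show "\<not> p \<subseteq> K" using zero_in_Gr[OF p] by auto
next
  assume nsub: "\<not> p \<subseteq> K"
  have pK: "vec.subspace (p \<inter> K)" using GrD(1)[OF p] K by (rule vec.subspace_inter)
  have "vec.dim (p \<inter> K) = 0"
  proof (rule ccontr)
    assume "vec.dim (p \<inter> K) \<noteq> 0"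
    then have "vec.dim p \<le> vec.dim (p \<inter> K)"
      using GrD(2)[OF p] by linarith
    then have "p \<inter> K = p"
      using vec.subspace_dim_equal[OF pK GrD(1)[OF p]] by blast
    with nsub show False by auto
  qed
  then show "p \<inter> K = {0}" using vec.subspace_0[OF pK] by auto
qed

lemma sum_points_split:
  fixes a :: "('a::{field,finite} ^ 'n) set \<Rightarrow> real"
  assumes "vec.subspace K"
  shows "(\<Sum>p\<in>Gr 1. a p) = subsum 1 a K + (\<Sum>p\<in>{p \<in> Gr 1. p \<inter> K = {0}}. a p)"
proof -
  have "{p \<in> Gr 1. p \<inter> K = {0}} = Gr 1 - {p \<in> Gr 1. p \<subseteq> K}"
    using point_avoids_iff[OF _ assms] by auto
  then show ?thesis
    using sum.subset_diff[of "{p \<in> Gr 1. p \<subseteq> K}" "Gr 1" a] by (simp add: subsum_def)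
qed

text \<open>The joining line, given by the property that turns two containments into one.\<close>

lemma distinct_points_join:
  assumes p: "p \<in> Gr 1" and p': "p' \<in> Gr 1" and "p \<noteq> p'"
  obtains L where "L \<in> Gr 2" "\<And>U. vec.subspace U \<Longrightarrow> L \<subseteq> U \<longleftrightarrow> p \<subseteq> U \<and> p' \<subseteq> U"
proof -
  let ?L = "{x + y |x y. x \<in> p \<and> y \<in> p'}"
  have "p \<inter> p' = {0}"
    using point_avoids_iff[OF p GrD(1)[OF p']] Gr_eqI[OF p p'] assms(3) by blast
  note S = Gr_sum[OF p p' this]
  have "?L \<subseteq> U \<longleftrightarrow> p \<subseteq> U \<and> p' \<subseteq> U" if "vec.subspace U" for U
  proof
    assume "p \<subseteq> U \<and> p' \<subseteq> U"
    then show "?L \<subseteq> U" using vec.subspace_add[OF that] by blast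
  qed (use S in blast)
  moreover have "?L \<in> Gr 2" using S(1) by (simp only: one_add_one)
  ultimately show thesis using that by blast
qed

section \<open>Point functions on 2-designs of subspaces\<close>

text \<open>The members of \<open>B\<close> are the blocks of a 2-design on the points of
  \<open>Y\<close>. In the sum over the blocks through \<open>p\<close>, the point \<open>p\<close>
  occurs \<open>c1\<close> times and every other point \<open>c2\<close> times.\<close>

lemma design_sum_through_point:
  fixes a :: "('a::{field,finite} ^ 'n) set \<Rightarrow> real" and c1 c2 :: real
  assumes B: "\<And>U. U \<in> B \<Longrightarrow> U \<subseteq> Y"
    and c1: "\<And>p. p \<in> Gr 1 \<Longrightarrow> p \<subseteq> Y \<Longrightarrow> card {U \<in> B. p \<subseteq> U} = c1"
    and c2: "\<And>p p'. p \<in> Gr 1 \<Longrightarrow> p' \<in> Gr 1 \<Longrightarrow> p \<subseteq> Y \<Longrightarrow> p' \<subseteq> Y \<Longrightarrow> p \<noteq> p'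
      \<Longrightarrow> card {U \<in> B. p \<subseteq> U \<and> p' \<subseteq> U} = c2"
    and p: "p \<in> Gr 1" "p \<subseteq> Y"
  shows "(\<Sum>U\<in>{U \<in> B. p \<subseteq> U}. subsum 1 a U) = (c1 - c2) * a p + c2 * subsum 1 a Y"
proof -
  have "(\<Sum>U\<in>{U \<in> B. p \<subseteq> U}. subsum 1 a U)
      = (\<Sum>p'\<in>Gr 1. \<Sum>U\<in>{U \<in> {U \<in> B. p \<subseteq> U}. p' \<subseteq> U}. a p')"
    unfolding subsum_def by (rule sum.swap_restrict) simp_all
  also have "\<dots> = (\<Sum>p'\<in>Gr 1. real (card {U \<in> B. p \<subseteq> U \<and> p' \<subseteq> U}) * a p')"
    by simp
  also have "\<dots> = (\<Sum>p'\<in>Gr 1. (if p' = p then (c1 - c2) * a p else 0) + (if p' \<subseteq> Y then c2 * a p' else 0))"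
  proof (rule sum.cong[OF refl])
    fix p' :: "('a ^ 'n) set" assume p': "p' \<in> Gr 1"
    consider "p' = p" | "p' \<noteq> p" "p' \<subseteq> Y" | "\<not> p' \<subseteq> Y" by blast
    then show "real (card {U \<in> B. p \<subseteq> U \<and> p' \<subseteq> U}) * a p'
      = (if p' = p then (c1 - c2) * a p else 0) + (if p' \<subseteq> Y then c2 * a p' else 0)"
    proof cases
      case 1
      then show ?thesis using c1[OF p] p by (simp add: algebra_simps)
    next
      case 2
      then show ?thesis using c2[OF p(1) p' p(2)] by simp
    next
      case 3
      then have "{U \<in> B. p \<subseteq> U \<and> p' \<subseteq> U} = {}" using B by blast
      then have "card {U \<in> B. p \<subseteq> U \<and> p' \<subseteq> U} = 0" by (metis card.empty)
      then show ?thesis using 3 p by auto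
    qed
  qed
  also have "\<dots> = (c1 - c2) * a p + c2 * subsum 1 a Y"
    using p by (simp add: sum.distrib subsum_def sum_distrib_left flip: sum.inter_filter)
  finally show ?thesis .
qed

text \<open>Block sums in {0, 1} equal their squares. Over all blocks, the sums add up to
  \<open>c1\<close> and the squares to (c1 - c2) \<Sum> a^2 + c2.\<close>

lemma design_sum_squares:
  fixes a :: "('a::{field,finite} ^ 'n) set \<Rightarrow> real" and c1 c2 :: real
  assumes B: "\<And>U. U \<in> B \<Longrightarrow> U \<subseteq> Y"
    and c1: "\<And>p. p \<in> Gr 1 \<Longrightarrow> p \<subseteq> Y \<Longrightarrow> card {U \<in> B. p \<subseteq> U} = c1"
    and c2: "\<And>p p'. p \<in> Gr 1 \<Longrightarrow> p' \<in> Gr 1 \<Longrightarrow> p \<subseteq> Y \<Longrightarrow> p' \<subseteq> Y \<Longrightarrow> p \<noteq> p'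
      \<Longrightarrow> card {U \<in> B. p \<subseteq> U \<and> p' \<subseteq> U} = c2"
    and bool: "\<And>U. U \<in> B \<Longrightarrow> subsum 1 a U \<in> {0, 1}" and total: "subsum 1 a Y = 1" and ne: "c1 \<noteq> c2"
  shows "subsum 1 (\<lambda>p. a p * a p) Y = 1"
proof -
  have swap: "(\<Sum>U\<in>B. \<Sum>p\<in>{p \<in> Gr 1. p \<subseteq> U}. f p U) = (\<Sum>p\<in>{p \<in> Gr 1. p \<subseteq> Y}. \<Sum>U\<in>{U \<in> B. p \<subseteq> U}. f p U)"
    for f :: "('a ^ 'n) set \<Rightarrow> ('a ^ 'n) set \<Rightarrow> real"
  proof -
    have "(\<Sum>U\<in>B. \<Sum>p\<in>{p \<in> Gr 1. p \<subseteq> U}. f p U) = (\<Sum>U\<in>B. \<Sum>p\<in>{p \<in> {p \<in> Gr 1. p \<subseteq> Y}. p \<subseteq> U}. f p U)"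
      using B by (intro sum.cong refl) auto
    also have "\<dots> = (\<Sum>p\<in>{p \<in> Gr 1. p \<subseteq> Y}. \<Sum>U\<in>{U \<in> B. p \<subseteq> U}. f p U)"
      by (rule sum.swap_restrict) simp_all
    finally show ?thesis .
  qed
  have "c1 = (\<Sum>U\<in>B. subsum 1 a U)"
    unfolding subsum_def swap using c1 total by (simp add: subsum_def flip: sum_distrib_left)
  also have "\<dots> = (\<Sum>U\<in>B. subsum 1 a U * subsum 1 a U)"
    by (intro sum.cong refl) (use bool in auto)
  also have "\<dots> = (\<Sum>U\<in>B. \<Sum>p\<in>{p \<in> Gr 1. p \<subseteq> U}. a p * subsum 1 a U)"
    by (simp add: subsum_def sum_distrib_right)
  also have "\<dots> = (\<Sum>p\<in>{p \<in> Gr 1. p \<subseteq> Y}. a p * (\<Sum>U\<in>{U \<in> B. p \<subseteq> U}. subsum 1 a U))"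
    unfolding swap by (simp add: sum_distrib_left)
  also have "\<dots> = (\<Sum>p\<in>{p \<in> Gr 1. p \<subseteq> Y}. (c1 - c2) * (a p * a p) + c2 * a p)"
  proof (rule sum.cong[OF refl])
    fix p assume "p \<in> {p \<in> Gr 1. p \<subseteq> Y}"
    then have eq: "(\<Sum>U\<in>{U \<in> B. p \<subseteq> U}. subsum 1 a U) = (c1 - c2) * a p + c2 * 1"
      using design_sum_through_point[OF B c1 c2, of p a] total by simp
    show "a p * (\<Sum>U\<in>{U \<in> B. p \<subseteq> U}. subsum 1 a U) = (c1 - c2) * (a p * a p) + c2 * a p"
      unfolding eq by (simp add: algebra_simps)
  qed
  also have "\<dots> = (c1 - c2) * subsum 1 (\<lambda>p. a p * a p) Y + c2 * subsum 1 a Y"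
    by (simp add: subsum_def sum.distrib sum_distrib_left)
  finally have "(c1 - c2) * subsum 1 (\<lambda>p. a p * a p) Y = (c1 - c2) * 1"
    unfolding total by algebra
  then show ?thesis using ne by simp
qed

text \<open>The number of \<open>r\<close>-spaces through two distinct points. For
  \<open>r = 1\<close> it is set to 0, since \<open>avoid_count\<close> would be an empty product,
  hence 1.\<close>

definition pair_count :: "nat \<Rightarrow> nat \<Rightarrow> nat \<Rightarrow> real" where
  "pair_count q n r = (if r = 1 then 0 else avoid_count q n 0 r 2)"

lemma card_star_pair:
  fixes p p' :: "('a::{field,finite} ^ 'n) set"
  assumes "p \<in> Gr 1" "p' \<in> Gr 1" "p \<noteq> p'" "1 \<le> r"
  shows "real (card {U \<in> Gr r. p \<subseteq> U \<and> p' \<subseteq> U}) = pair_count CARD('a) CARD('n) r"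
proof -
  obtain L where L: "L \<in> Gr 2" "\<And>U. vec.subspace U \<Longrightarrow> L \<subseteq> U \<longleftrightarrow> p \<subseteq> U \<and> p' \<subseteq> U"
    using distinct_points_join[OF assms(1-3)] by metis
  then have eq: "{U \<in> Gr r. p \<subseteq> U \<and> p' \<subseteq> U} = {U \<in> Gr r. L \<subseteq> U}"
    using GrD(1) by blast
  show ?thesis
  proof (cases "r = 1")
    case True
    then have "{U \<in> Gr r. L \<subseteq> U} = {}" using Gr_dim_le[OF L(1), of _ 1] by auto
    then have "card {U \<in> Gr r. L \<subseteq> U} = 0" by (metis card.empty)
    then show ?thesis unfolding eq using True by (simp add: pair_count_def)
  next
    case False
    then show ?thesis unfolding eq using card_star[OF L(1), of r] assms(4) by (simp add: pair_count_def)
  qed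
qed

text \<open>The quotient is [r-1] / [n-1] for \<open>r > 1\<close>. The design identities can
  therefore be divided by \<open>c1 - c2\<close>.\<close>

lemma pair_count_less:
  assumes "1 \<le> r" "r < n" "0 < q"
  shows "pair_count q n r < avoid_count q n 0 r 1"
proof (cases "r = 1")
  case False
  have pos: "avoid_count q n 0 r j > 0" for j using assms by (intro avoid_count_pos) auto
  have "avoid_count q n 0 r 1 * qint q (r - 1) = qint q (n - 1) * avoid_count q n 0 r 2"
    using avoid_count_step[of 1 r q n 0] assms False by (simp add: numeral_2_eq_2)
  moreover have "real (qint q (r - 1)) < qint q (n - 1)"
    using assms False by (simp add: qint_strict_mono)
  ultimately have "avoid_count q n 0 r 2 * qint q (r - 1) < avoid_count q n 0 r 1 * qint q (r - 1)"
    using pos[of 2] by (simp add: mult.commute)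
  then show ?thesis using False by (simp add: pair_count_def mult_less_cancel_right)
qed (simp add: pair_count_def)

text \<open>The point function \<open>a\<close> representing the indicator of \<open>S\<close> is
  supported on points common to all members of \<open>S\<close>; comparing sizes shows that
  \<open>S\<close> is the star of such a point.\<close>

lemma erdos_ko_rado_uniqueness:
  fixes S :: "('a::{field,finite} ^ 'n) set set"
  assumes r: "1 \<le> r" "2 * r < CARD('n)" and S: "S \<subseteq> Gr r"
    and int: "\<And>U V. U \<in> S \<Longrightarrow> V \<in> S \<Longrightarrow> U \<inter> V \<noteq> {0}"
    and size: "card S * qint CARD('a) CARD('n) = card (Gr r :: ('a ^ 'n) set set) * qint CARD('a) r"
  shows "\<exists>p\<in>Gr 1. S = {U \<in> Gr r. p \<subseteq> U}"
proof -
  let ?q = "CARD('a)" and ?n = "CARD('n)"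
  obtain a where a: "\<And>U. U \<in> Gr r \<Longrightarrow> subsum 1 a U = indicator S U"
    using intersecting_family(2)[OF r S int size] by auto
  have "(Gr r :: ('a ^ 'n) set set) \<noteq> {}" using r by (intro Gr_nonempty) auto
  then have "card (Gr r :: ('a ^ 'n) set set) * qint ?q r > 0"
    using r by (simp add: card_gt_0_iff qint_pos)
  then have "card S > 0" using size by (metis mult_is_0 neq0_conv)
  then have "S \<noteq> {}" by auto
  \<comment> \<open>An \<open>r\<close>-space avoiding \<open>K\<close> also avoids
    \<open>U\<close>, so it lies outside \<open>S\<close> and its \<open>a\<close>-sum is 0. Since
    \<open>k + r \<le> n\<close>, the factor in \<open>sum_subsum_disjoint\<close> is positive, and
    the points outside \<open>K\<close> sum to 0.\<close>
  have sum_eq: "subsum 1 a K = (\<Sum>p\<in>Gr 1. a p)"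
    if K: "K \<in> Gr k" "k + r \<le> ?n" "U \<in> S" "U \<subseteq> K" for K k U
  proof -
    have "avoid_count ?q ?n k r 1 * (\<Sum>p\<in>{p \<in> Gr 1. p \<inter> K = {0}}. a p)
      = (\<Sum>V\<in>{V \<in> Gr r. V \<inter> K = {0}}. subsum 1 a V)"
      using sum_subsum_disjoint[OF K(1) r(1)] by simp
    also have "\<dots> = 0"
    proof (intro sum.neutral ballI)
      fix V assume V: "V \<in> {V \<in> Gr r. V \<inter> K = {0}}"
      then have "V \<inter> K = {0}" "0 \<in> V" "0 \<in> U"
        using zero_in_Gr[of V r] zero_in_Gr[of U r] S K(3) by auto
      then have "V \<inter> U = {0}" using K(4) by blast
      then have "V \<notin> S" using int K(3) by blast
      then show "subsum 1 a V = 0" using V a by simp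
    qed
    finally have "(\<Sum>p\<in>{p \<in> Gr 1. p \<inter> K = {0}}. a p) = 0"
      using avoid_count_pos[of r k ?n ?q 1] K(2) by simp
    then show ?thesis using sum_points_split[OF GrD(1)[OF K(1)], of a] by simp
  qed
  have total: "(\<Sum>p\<in>Gr 1. a p) = 1"
  proof -
    obtain U where U: "U \<in> S" using \<open>S \<noteq> {}\<close> by blast
    then show ?thesis using sum_eq[of U r U] a[of U] S r by auto
  qed
  have squares: "(\<Sum>p\<in>Gr 1. a p * a p) = 1"
  proof -
    have "subsum 1 (\<lambda>p. a p * a p) UNIV = 1"
    proof (rule design_sum_squares[of "Gr r" _ "avoid_count ?q ?n 0 r 1" "pair_count ?q ?n r"])
      show "real (card {U \<in> Gr r. p \<subseteq> U \<and> p' \<subseteq> U}) = pair_count ?q ?n r"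
        if "p \<in> Gr 1" "p' \<in> Gr 1" "p \<noteq> p'" for p p' :: "('a ^ 'n) set"
        using card_star_pair[OF that r(1)] .
      show "avoid_count ?q ?n 0 r 1 \<noteq> pair_count ?q ?n r"
        using pair_count_less[of r ?n ?q] r by simp
    qed (use a total r card_star[of _ 1 r] in \<open>auto simp: subsum_def indicator_def\<close>)
    then show ?thesis by (simp add: subsum_def)
  qed
  \<comment> \<open>\<open>n > 2 * r\<close> admits \<open>k = r + 1\<close> in
    \<open>sum_eq\<close>. The hyperplanes of \<open>K\<close> form a design as well, so the squares
    of \<open>a\<close> already sum to 1 inside \<open>K\<close> and vanish outside.\<close>
  have supp_K: "a p = 0" if K: "K \<in> Gr (Suc r)" "U \<in> S" "U \<subseteq> K" and p: "p \<in> Gr 1" "\<not> p \<subseteq> K" for K U p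
  proof -
    have 1: "subsum 1 a K = 1"
      using sum_eq[OF K(1) _ K(2,3)] total r by simp
    have "subsum 1 (\<lambda>p. a p * a p) K = 1"
    proof (rule design_sum_squares[of "{U \<in> Gr r. U \<subseteq> K}" _ "qint ?q r" "qint ?q (r - 1)"])
      show "real (card {U \<in> {U \<in> Gr r. U \<subseteq> K}. p \<subseteq> U}) = qint ?q r" if "p \<in> Gr 1" "p \<subseteq> K" for p
      proof -
        have "{U \<in> {U \<in> Gr r. U \<subseteq> K}. p \<subseteq> U} = {U \<in> Gr r. p \<subseteq> U \<and> U \<subseteq> K}" by auto
        then show ?thesis using card_hyperplanes_containing[OF that(1) K(1) that(2)] by simp
      qed
      show "real (card {U \<in> {U \<in> Gr r. U \<subseteq> K}. p \<subseteq> U \<and> p' \<subseteq> U}) = qint ?q (r - 1)"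
        if pp: "p \<in> Gr 1" "p' \<in> Gr 1" "p \<subseteq> K" "p' \<subseteq> K" "p \<noteq> p'" for p p'
      proof -
        obtain L where L: "L \<in> Gr 2" "\<And>U. vec.subspace U \<Longrightarrow> L \<subseteq> U \<longleftrightarrow> p \<subseteq> U \<and> p' \<subseteq> U"
          using distinct_points_join[OF pp(1,2,5)] by metis
        have "{U \<in> {U \<in> Gr r. U \<subseteq> K}. p \<subseteq> U \<and> p' \<subseteq> U} = {U \<in> Gr r. L \<subseteq> U \<and> U \<subseteq> K}"
          using L(2) GrD(1) by blast
        moreover have "L \<subseteq> K" using L(2)[OF GrD(1)[OF K(1)]] pp by blast
        moreover have "Suc r - 2 = r - 1" by simp
        ultimately show ?thesis using card_hyperplanes_containing[OF L(1) K(1)] by simp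
      qed
      show "real (qint ?q r) \<noteq> real (qint ?q (r - 1))"
        using qint_strict_mono[of ?q "r - 1" r] r by simp
    qed (use a 1 in \<open>auto simp: indicator_def\<close>)
    then have "(\<Sum>p\<in>{p \<in> Gr 1. p \<inter> K = {0}}. a p * a p) = 0"
      using sum_points_split[OF GrD(1)[OF K(1)], of "\<lambda>p. a p * a p"] squares by simp
    moreover have "p \<in> {p \<in> Gr 1. p \<inter> K = {0}}"
      using p point_avoids_iff[OF p(1) GrD(1)[OF K(1)]] by simp
    ultimately show ?thesis
      using sum_nonneg_eq_0_iff[of "{p \<in> Gr 1. p \<inter> K = {0}}" "\<lambda>p. a p * a p"] by simp
  qed
  obtain p where p: "p \<in> Gr 1" "a p \<noteq> 0"
    using total by (metis sum.neutral zero_neq_one)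
  have "p \<subseteq> U" if U: "U \<in> S" for U
  proof (rule ccontr)
    assume "\<not> p \<subseteq> U"
    have Ur: "U \<in> Gr r" using U S by auto
    have "U \<inter> p = {0}"
      using point_avoids_iff[OF p(1) GrD(1)[OF Ur]] \<open>\<not> p \<subseteq> U\<close> by (simp add: Int_commute)
    \<comment> \<open>If \<open>p\<close> were outside \<open>U\<close>, some cover of
      \<open>U\<close> would avoid \<open>p\<close> too, against \<open>supp_K\<close>.\<close>
    then have "card {K \<in> Gr (Suc r). U \<subseteq> K \<and> K \<inter> p = {0}} > 0"
      using card_covers_avoiding[OF Ur p(1)] qint_pos[of ?q "?n - 1 - r"] r by simp
    then have "{K \<in> Gr (Suc r). U \<subseteq> K \<and> K \<inter> p = {0}} \<noteq> {}"
      by (metis card.empty less_irrefl)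
    then obtain K where K: "K \<in> Gr (Suc r)" "U \<subseteq> K" "K \<inter> p = {0}" by auto
    have "\<not> p \<subseteq> K"
      using point_avoids_iff[OF p(1) GrD(1)[OF K(1)]] K(3) by (simp add: Int_commute)
    then show False using supp_K[OF K(1) U K(2) p(1)] p(2) by simp
  qed
  then have sub: "S \<subseteq> {U \<in> Gr r. p \<subseteq> U}" using S by auto
  have "real (card S * qint ?q ?n) = real (card {U \<in> Gr r. p \<subseteq> U} * qint ?q ?n)"
    unfolding size using card_star_point[OF p(1) r(1)] by simp
  then have "card S = card {U \<in> Gr r. p \<subseteq> U}"
    using qint_pos[of ?q ?n] by (simp only: of_nat_eq_iff) simp
  then have "S = {U \<in> Gr r. p \<subseteq> U}"
    using card_subset_eq[OF _ sub] by simp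
  then show ?thesis using p(1) by blast
qed

section \<open>Homomorphisms\<close>

text \<open>Spaces whose images share the point \<open>p'\<close> cannot be adjacent, so they form
  an intersecting family. The hypothesis \<open>ratio\<close> says that the average size of these
  families over all points is the extremal one.\<close>

lemma hom_preimage_star:
  fixes f :: "('a::{field,finite} ^ 'n) set \<Rightarrow> ('b::{field,finite} ^ 'm) set"
  assumes r: "1 \<le> r" "2 * r < CARD('n)"
    and ratio: "qint CARD('a) CARD('n) * qint CARD('b) r' = qint CARD('b) CARD('m) * qint CARD('a) r"
    and hom: "qkneser_hom r r' f" and p': "p' \<in> Gr 1"
  shows "\<exists>p. p \<in> Gr 1 \<and> (\<forall>U\<in>Gr r. p' \<subseteq> f U \<longleftrightarrow> p \<subseteq> U)"
proof -
  let ?q = "CARD('a)" and ?n = "CARD('n)" and ?q' = "CARD('b)" and ?n' = "CARD('m)"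
  let ?X = "Gr r :: ('a ^ 'n) set set" and ?P = "Gr 1 :: ('b ^ 'm) set set"
  define S where "S p' = {U \<in> ?X. p' \<subseteq> f U}" for p'
  have f: "f U \<in> Gr r'" if "U \<in> ?X" for U
    using hom that by (simp add: qkneser_hom_def)
  have int: "U \<inter> V \<noteq> {0}" if p: "p \<in> ?P" and UV: "U \<in> S p" "V \<in> S p" for p U V
  proof
    assume "U \<inter> V = {0}"
    then have "f U \<inter> f V = {0}"
      using hom UV by (simp add: qkneser_hom_def qkneser_adj_def S_def)
    then have "p \<subseteq> {0}" using UV by (auto simp: S_def)
    then show False using GrD(2)[OF p] by (simp flip: vec.dim_eq_0)
  qed
  have S: "S p \<subseteq> ?X" for p by (auto simp: S_def)
  have le: "card (S p) * qint ?q ?n \<le> card ?X * qint ?q r" if "p \<in> ?P" for p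
    using intersecting_family(1)[OF r S int[OF that]] .
  have "(\<Sum>p\<in>?P. card (S p)) = (\<Sum>U\<in>?X. card {p \<in> ?P. p \<subseteq> f U})"
    unfolding S_def by (rule sum_card_swap) simp_all
  also have "\<dots> = card ?X * qint ?q' r'"
    using card_points[OF f] by simp
  finally have "(\<Sum>p\<in>?P. card (S p) * qint ?q ?n) = card ?X * (qint ?q ?n * qint ?q' r')"
    by (simp flip: sum_distrib_right)
  also have "\<dots> = card ?P * (card ?X * qint ?q r)"
    using card_points[OF UNIV_Gr, where ?'a = 'b and ?'n = 'm] by (simp add: ratio)
  finally have "(\<Sum>p\<in>?P. card (S p) * qint ?q ?n) = (\<Sum>p\<in>?P. card ?X * qint ?q r)"
    by simp
  \<comment> \<open>Termwise inequality together with equal sums forces equality in each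
    term.\<close>
  then have size: "card (S p') * qint ?q ?n = card ?X * qint ?q r"
    by (rule sum_mono_inv) (use le p' in auto)
  obtain p where p: "p \<in> Gr 1" "S p' = {U \<in> Gr r. p \<subseteq> U}"
    using erdos_ko_rado_uniqueness[of r "S p'", OF r S int[OF p'] size] by auto
  have "p' \<subseteq> f U \<longleftrightarrow> p \<subseteq> U" if "U \<in> Gr r" for U
    using arg_cong[OF p(2), of "\<lambda>A. U \<in> A"] that by (simp add: S_def)
  with p(1) show ?thesis by auto
qed

text \<open>In the design of all \<open>r\<close>-spaces, the sum over the blocks through a point is
  \<open>?c1 * s\<close> for every point and determines the value of \<open>w\<close> there.\<close>

lemma constant_of_constant_subsum:
  fixes w :: "('a::{field,finite} ^ 'n) set \<Rightarrow> real"
  assumes r: "1 \<le> r" "r < CARD('n)" and w: "\<And>U. U \<in> Gr r \<Longrightarrow> subsum 1 w U = s"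
    and p: "p \<in> Gr 1" "p' \<in> Gr 1"
  shows "w p = w p'"
proof -
  let ?c1 = "avoid_count CARD('a) CARD('n) 0 r 1" and ?c2 = "pair_count CARD('a) CARD('n) r"
  have "(?c1 - ?c2) * w p + ?c2 * subsum 1 w UNIV = ?c1 * s" if p: "p \<in> Gr 1" for p
  proof -
    have "(?c1 - ?c2) * w p + ?c2 * subsum 1 w UNIV = (\<Sum>U\<in>{U \<in> Gr r. p \<subseteq> U}. subsum 1 w U)"
      using card_star[OF _ r(1)] card_star_pair[OF _ _ _ r(1)] p
      by (intro design_sum_through_point[symmetric]) simp_all
    also have "\<dots> = ?c1 * s"
      using w card_star[OF p r(1)] by simp
    finally show ?thesis .
  qed
  from this[OF p(1)] this[OF p(2)] have "(?c1 - ?c2) * w p = (?c1 - ?c2) * w p'"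
    by linarith
  then show ?thesis using pair_count_less[OF r, of "CARD('a)"] by simp
qed

text \<open>Hence the points of \<open>K\<close> are exactly those common to all
  \<open>r\<close>-spaces above \<open>K\<close>.\<close>

lemma exists_Gr_avoiding_point:
  fixes K :: "('a::{field,finite} ^ 'n) set"
  assumes K: "K \<in> Gr k" and "k \<le> r" "r < CARD('n)" and p: "p \<in> Gr 1" and "\<not> p \<subseteq> K"
  shows "\<exists>U\<in>Gr r. K \<subseteq> U \<and> \<not> p \<subseteq> U"
proof -
  have "K \<inter> p = {0}"
    using point_avoids_iff[OF p GrD(1)[OF K]] assms(5) by (simp add: Int_commute)
  then have "real (card {U \<in> Gr r. K \<subseteq> U \<and> U \<inter> p = {0}}) > 0"
    using card_avoiding[OF K p _ assms(2)] avoid_count_pos[of r 1 "CARD('n)" "CARD('a)" k] assms(3) by simp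
  then have "{U \<in> Gr r. K \<subseteq> U \<and> U \<inter> p = {0}} \<noteq> {}"
    by (metis card.empty less_irrefl of_nat_0)
  then obtain U where U: "U \<in> Gr r" "K \<subseteq> U" "U \<inter> p = {0}" by auto
  then show ?thesis
    using point_avoids_iff[OF p GrD(1)[OF U(1)]] by (auto simp: Int_commute)
qed

lemma exists_Gr_superset:
  fixes K :: "('a::{field,finite} ^ 'n) set"
  assumes "K \<in> Gr k" "k \<le> r" "r \<le> CARD('n)"
  obtains U where "U \<in> Gr r" "K \<subseteq> U"
proof -
  have "real (card {U \<in> Gr r. K \<subseteq> U}) > 0"
    using card_star[OF assms(1,2)] avoid_count_pos[of r 0 "CARD('n)" "CARD('a)" k] assms(3) by simp
  then have "{U \<in> Gr r. K \<subseteq> U} \<noteq> {}"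
    by (metis card.empty less_irrefl of_nat_0)
  then show thesis using that by auto
qed

lemma exists_Gr:
  assumes "k \<le> CARD('n)"
  obtains K :: "('a::{field,finite} ^ 'n) set" where "K \<in> Gr k"
  using Gr_nonempty[OF assms, where ?'a = 'a] by blast

text \<open>\<open>c\<close> is the common size of the fibres of the induced map \<phi> from target
  points to source points.\<close>

lemma kneser_hom_scaling:
  fixes f :: "('a::{field,finite} ^ 'n) set \<Rightarrow> ('b::{field,finite} ^ 'm) set"
  assumes r: "1 \<le> r" "2 * r < CARD('n)"
    and ratio: "qint CARD('a) CARD('n) * qint CARD('b) r' = qint CARD('b) CARD('m) * qint CARD('a) r"
    and hom: "qkneser_hom r r' f"
  obtains c where "qint CARD('b) CARD('m) = c * qint CARD('a) CARD('n)"
    "\<And>k. k \<le> r \<Longrightarrow> \<exists>k'\<le>r'. qint CARD('b) k' = c * qint CARD('a) k"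
    "qint CARD('b) r' = c * qint CARD('a) r"
proof -
  let ?q = "CARD('a)" and ?n = "CARD('n)" and ?q' = "CARD('b)" and ?n' = "CARD('m)"
  let ?P' = "Gr 1 :: ('b ^ 'm) set set" and ?P = "Gr 1 :: ('a ^ 'n) set set"
  obtain \<phi> where \<phi>: "\<And>p'. p' \<in> ?P' \<Longrightarrow> \<phi> p' \<in> ?P"
    and \<phi>_iff: "\<And>p' U. p' \<in> ?P' \<Longrightarrow> U \<in> Gr r \<Longrightarrow> p' \<subseteq> f U \<longleftrightarrow> \<phi> p' \<subseteq> U"
  proof -
    have "\<forall>p'\<in>?P'. \<exists>p. p \<in> ?P \<and> (\<forall>U\<in>Gr r. p' \<subseteq> f U \<longleftrightarrow> p \<subseteq> U)"
      using hom_preimage_star[OF r ratio hom] by simp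
    from bchoice[OF this] obtain \<phi>
      where "\<forall>p'\<in>?P'. \<phi> p' \<in> ?P \<and> (\<forall>U\<in>Gr r. p' \<subseteq> f U \<longleftrightarrow> \<phi> p' \<subseteq> U)" ..
    then show thesis by (intro that[of \<phi>]) simp_all
  qed
  have f: "f U \<in> Gr r'" if "U \<in> Gr r" for U
    using hom that by (simp add: qkneser_hom_def)
  define w where "w p = card {p' \<in> ?P'. \<phi> p' = p}" for p
  have w_sum: "(\<Sum>p\<in>{p \<in> ?P. p \<subseteq> Y}. w p) = card {p' \<in> ?P'. \<phi> p' \<subseteq> Y}" for Y
  proof -
    have "{p' \<in> ?P'. \<phi> p' \<subseteq> Y} = (\<Union>p\<in>{p \<in> ?P. p \<subseteq> Y}. {p' \<in> ?P'. \<phi> p' = p})"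
      using \<phi> by auto
    then have "card {p' \<in> ?P'. \<phi> p' \<subseteq> Y} = card (\<Union>p\<in>{p \<in> ?P. p \<subseteq> Y}. {p' \<in> ?P'. \<phi> p' = p})"
      by (rule arg_cong)
    also have "\<dots> = (\<Sum>p\<in>{p \<in> ?P. p \<subseteq> Y}. w p)"
      unfolding w_def by (rule card_UN_disjoint) auto
    finally show ?thesis ..
  qed
  \<comment> \<open>The fibres over the points of \<open>U\<close> together make up the points of
    \<open>f U\<close>.\<close>
  have w_Gr: "(\<Sum>p\<in>{p \<in> ?P. p \<subseteq> U}. w p) = qint ?q' r'" if U: "U \<in> Gr r" for U
  proof -
    have "{p' \<in> ?P'. \<phi> p' \<subseteq> U} = {p' \<in> ?P'. p' \<subseteq> f U}"
      using \<phi>_iff[OF _ U] by auto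
    then show ?thesis unfolding w_sum using card_points[OF f[OF U]] by simp
  qed
  obtain p0 where p0: "p0 \<in> ?P"
    using exists_Gr[of 1, where ?'a = 'a and ?'n = 'n] r by auto
  have w: "w p = w p0" if "p \<in> ?P" for p
  proof -
    have "real (w p) = real (w p0)"
    proof (rule constant_of_constant_subsum[OF r(1)])
      show "subsum 1 (\<lambda>p. real (w p)) U = qint ?q' r'" if "U \<in> Gr r" for U
        using w_Gr[OF that] by (simp add: subsum_def flip: of_nat_sum)
    qed (use r p0 that in auto)
    then show ?thesis by simp
  qed
  have w_card: "card {p' \<in> ?P'. \<phi> p' \<subseteq> K} = w p0 * qint ?q k" if K: "K \<in> Gr k" for K k
    unfolding w_sum[symmetric] using w card_points[OF K] by simp
  show thesis
  proof
    show "qint ?q' ?n' = w p0 * qint ?q ?n"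
      using w_card[OF UNIV_Gr] card_points[OF UNIV_Gr, where ?'a = 'b and ?'n = 'm] by simp
    obtain U :: "('a ^ 'n) set" where U: "U \<in> Gr r"
      using exists_Gr[of r, where ?'a = 'a and ?'n = 'n] r by auto
    show "qint ?q' r' = w p0 * qint ?q r"
      using w_Gr[OF U] w_card[OF U] unfolding w_sum by simp
  next
    fix k assume k: "k \<le> r"
    obtain K :: "('a ^ 'n) set" where K: "K \<in> Gr k"
      using exists_Gr[of k, where ?'a = 'a and ?'n = 'n] k r by auto
    \<comment> \<open>A subspace whose points are those that \<phi> maps into \<open>K\<close>, so
      that its dimension is the desired \<open>k'\<close>.\<close>
    define M where "M = (\<Inter>U\<in>{U \<in> Gr r. K \<subseteq> U}. f U)"
    have M: "vec.subspace M"
      unfolding M_def by (rule vec.subspace_Inter) (use f GrD(1) in blast)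
    have "p' \<subseteq> M \<longleftrightarrow> \<phi> p' \<subseteq> K" if p': "p' \<in> ?P'" for p'
    proof
      assume M: "p' \<subseteq> M"
      show "\<phi> p' \<subseteq> K"
      proof (rule ccontr)
        assume "\<not> \<phi> p' \<subseteq> K"
        then obtain U where U: "U \<in> Gr r" "K \<subseteq> U" "\<not> \<phi> p' \<subseteq> U"
          using exists_Gr_avoiding_point[OF K k _ \<phi>[OF p']] r by auto
        then have "M \<subseteq> f U" by (auto simp: M_def)
        then show False using M U \<phi>_iff[OF p' U(1)] by auto
      qed
    next
      assume "\<phi> p' \<subseteq> K"
      then have "p' \<subseteq> f U" if "U \<in> Gr r" "K \<subseteq> U" for U
        using \<phi>_iff[OF p' that(1)] that(2) by auto
      then show "p' \<subseteq> M" by (auto simp: M_def)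
    qed
    then have "{p' \<in> ?P'. p' \<subseteq> M} = {p' \<in> ?P'. \<phi> p' \<subseteq> K}" by auto
    then have "qint ?q' (vec.dim M) = w p0 * qint ?q k"
      using card_points[OF subspace_Gr[OF M]] w_card[OF K] by simp
    \<comment> \<open>The intersection defining \<open>M\<close> is not empty, which bounds its
      dimension by \<open>r'\<close>.\<close>
    moreover obtain U where U: "U \<in> Gr r" "K \<subseteq> U"
      using exists_Gr_superset[OF K k] r by auto
    then have "M \<subseteq> f U" by (auto simp: M_def)
    then have "vec.dim M \<le> r'"
      using Gr_dim_le[OF subspace_Gr[OF M] f[OF U(1)]] by simp
    ultimately show "\<exists>k'\<le>r'. qint ?q' k' = w p0 * qint ?q k" by blast
  qed
qed

theorem theorem5p3:
  fixes f :: "('a::{field,finite} ^ 'n) set \<Rightarrow> ('b::{field,finite} ^ 'm) set"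
    and r r' :: nat
  defines "q \<equiv> CARD('a)" and "q' \<equiv> CARD('b)" and "n \<equiv> CARD('n)" and "n' \<equiv> CARD('m)"
  assumes "1 \<le> r" and "1 \<le> r'"
    and "n > 2 * r" and "n' > 2 * r'"
    and "(of_nat (qint q n) / of_nat (qint q r) :: rat) = of_nat (qint q' n') / of_nat (qint q' r')"
    and "qkneser_hom r r' f"
  shows "{(of_nat (qint q k) / of_nat (qint q r) :: rat) | k. k \<in> {1..r}}
           \<subseteq> {of_nat (qint q' k') / of_nat (qint q' r') | k'. k' \<in> {1..r'}}
      \<and> qint q n dvd qint q' n' \<and> qint q r dvd qint q' r'"
proof -
  have pos: "0 < qint q r" "0 < qint q' r'"
    using assms(5,6) by (simp_all add: q_def q'_def qint_pos)
  have "(of_nat (qint q n * qint q' r') :: rat) = of_nat (qint q' n' * qint q r)"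
    using assms(9) pos by (simp add: frac_eq_eq)
  then have ratio: "qint q n * qint q' r' = qint q' n' * qint q r"
    by (simp only: of_nat_eq_iff)
  obtain c where cn: "qint q' n' = c * qint q n"
    and ck: "\<And>k. k \<le> r \<Longrightarrow> \<exists>k'\<le>r'. qint q' k' = c * qint q k"
    and cr: "qint q' r' = c * qint q r"
    using kneser_hom_scaling[of r r' f] assms(5,7,10) ratio unfolding q_def q'_def n_def n'_def by blast
  have c: "0 < c" using cr pos by (metis mult_is_0 neq0_conv)
  have "\<exists>k'. (of_nat (qint q k) / of_nat (qint q r) :: rat) = of_nat (qint q' k') / of_nat (qint q' r')
      \<and> k' \<in> {1..r'}" if k: "k \<in> {1..r}" for k
  proof -
    obtain k' where k': "k' \<le> r'" "qint q' k' = c * qint q k"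
      using ck k by auto
    \<comment> \<open>Positivity excludes \<open>k' = 0\<close>, which the bound
      \<open>k' \<le> r'\<close> leaves open.\<close>
    have "0 < qint q k" using k by (simp add: q_def qint_pos)
    then have "k' \<noteq> 0" using k'(2) c by (metis mult_is_0 neq0_conv qint_0)
    moreover have "(of_nat (qint q k) / of_nat (qint q r) :: rat) = of_nat (qint q' k') / of_nat (qint q' r')"
      unfolding k'(2) cr using c by simp
    ultimately show ?thesis using k'(1) by auto
  qed
  then show ?thesis using cn cr by auto
qed

end
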